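(* Let $\mathbb{H}$ and $\mathbb{K}$ be complex Hilbert spaces, and let $A$ be a bounded linear operator on $\mathbb{H}$ and $B$ a bounded linear operator on $\mathbb{K}$. Then $$w(A \otimes B) \geq \frac{1}{2}\|A\|\|B\|+ \frac{1}{4}\Big|\,\|A \otimes B+A^* \otimes B^*\|-\|A \otimes B-A^* \otimes B^*\|\,\Big|.$$
   Context: For a bounded linear operator $T$ on a complex Hilbert space with inner product $\langle\cdot,\cdot\rangle$, the numerical radius is $w(T)=\sup\{|\langle Tx,x\rangle| : \|x\|=1\}$, and $\|T\|$ is the operator norm. $\mathbb{H}\otimes\mathbb{K}$ is the Hilbert space tensor product (the completion of the algebraic tensor product under the inner product determined by $\langle x\otimes y,z\otimes u\rangle=\langle x,z\rangle\langle y,u\rangle$), and $A\otimes B$ is the bounded linear operator on $\mathbb{H}\otimes\mathbb{K}$ determined by $(A\otimes B)(x\otimes y)=Ax\otimes By$. *)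

theory Defs
  imports "HOL-Analysis.Analysis" "HOL-Library.Poly_Mapping"
begin

section \<open>Complex Hilbert spaces\<close>

class complex_vector = real_vector +
  fixes scaleC :: "complex \<Rightarrow> 'a \<Rightarrow> 'a"  (infixr "*\<^sub>C" 75)
  assumes scaleC_add_right: "c *\<^sub>C (x + y) = c *\<^sub>C x + c *\<^sub>C y"
    and scaleC_add_left: "(c + d) *\<^sub>C x = c *\<^sub>C x + d *\<^sub>C x"
    and scaleC_scaleC: "c *\<^sub>C d *\<^sub>C x = (c * d) *\<^sub>C x"
    and scaleC_one: "1 *\<^sub>C x = x"
    and scaleR_scaleC: "r *\<^sub>R x = complex_of_real r *\<^sub>C x"

text \<open>The inner product is linear in the first argument and conjugate-linear in the second.\<close>

class complex_inner = complex_vector + real_normed_vector +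
  fixes cinner :: "'a \<Rightarrow> 'a \<Rightarrow> complex"
  assumes cinner_commute: "cinner x y = cnj (cinner y x)"
    and cinner_add_left: "cinner (x + y) z = cinner x z + cinner y z"
    and cinner_scaleC_left: "cinner (c *\<^sub>C x) y = c * cinner x y"
    and cinner_ge_zero: "0 \<le> Re (cinner x x)"
    and cinner_eq_zero_iff: "cinner x x = 0 \<longleftrightarrow> x = 0"
    and norm_eq_sqrt_cinner: "norm x = sqrt (Re (cinner x x))"

class chilbert_space = complex_inner + complete_space

instance chilbert_space \<subseteq> banach ..

lemma scaleC_zero_left [simp]: "0 *\<^sub>C (x::'a::complex_vector) = 0"
  using scaleC_add_left[of 0 0 x] by simp

lemma scaleC_zero_right [simp]: "c *\<^sub>C (0::'a::complex_vector) = 0"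
  using scaleC_add_right[of c 0 "0::'a"] by simp

lemma scaleC_minus1 [simp]: "(-1) *\<^sub>C (x::'a::complex_vector) = - x"
  using scaleC_add_left[of 1 "-1" x] by (simp add: scaleC_one eq_neg_iff_add_eq_0 add.commute)

lemma scaleC_sum_right: "c *\<^sub>C (\<Sum>i\<in>I. f i :: 'a::complex_vector) = (\<Sum>i\<in>I. c *\<^sub>C f i)"
  by (induction I rule: infinite_finite_induct) (auto simp: scaleC_add_right)

subsection \<open>Norms from definite Hermitian forms\<close>

locale hermitian_form =
  fixes f :: "'v::complex_vector \<Rightarrow> 'v \<Rightarrow> complex"
  assumes sym: "f x y = cnj (f y x)"
    and add_left: "f (x + y) z = f x z + f y z"
    and scale_left: "f (c *\<^sub>C x) y = c * f x y"
    and ge_zero: "0 \<le> Re (f x x)"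
    and zero_imp: "f x x = 0 \<Longrightarrow> x = 0"
begin

lemma add_right: "f x (y + z) = f x y + f x z"
  by (metis sym add_left complex_cnj_add)

lemma scale_right: "f x (c *\<^sub>C y) = cnj c * f x y"
  by (metis sym scale_left complex_cnj_mult)

lemma zero_left [simp]: "f 0 y = 0"
  using scale_left[of 0 0 y] by simp

lemma zero_right [simp]: "f x 0 = 0"
  using scale_right[of x 0 0] by simp

lemma Im_self [simp]: "Im (f x x) = 0"
  using sym[of x x] by (metis cnj.simps(2) neg_equal_zero)

lemma self_eq_of_real: "f x x = complex_of_real (Re (f x x))"
  by (simp add: complex_eq_iff)

lemma eq_zero_iff: "f x x = 0 \<longleftrightarrow> x = 0"
  using zero_imp by auto

lemma cauchy_schwarz: "(cmod (f x y))\<^sup>2 \<le> Re (f x x) * Re (f y y)"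
proof (cases "y = 0")
  case False
  define b where "b = f x y"
  define k where "k = Re (f y y)"
  have k: "f y y = complex_of_real k" unfolding k_def by (rule self_eq_of_real)
  have "k \<noteq> 0" using zero_imp[of y] False k by auto
  moreover have "k \<ge> 0" unfolding k_def by (rule ge_zero)
  ultimately have k0: "k > 0" by simp
  define s where "s = - (b / complex_of_real k)"
  have yx: "f y x = cnj b" unfolding b_def by (rule sym)
  have "f (x + s *\<^sub>C y) (x + s *\<^sub>C y) = f x x + cnj s * b + s * cnj b + s * cnj s * k"
    by (simp add: add_left add_right scale_left scale_right yx k b_def[symmetric] algebra_simps)
  also have "\<dots> = f x x - complex_of_real ((cmod b)\<^sup>2 / k)"
    using k0 by (simp add: s_def complex_norm_square field_simps del: of_real_power)
  finally have "0 \<le> Re (f x x) - (cmod b)\<^sup>2 / k"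
    using ge_zero[of "x + s *\<^sub>C y"] by simp
  then show ?thesis using k0 by (simp add: b_def k_def field_simps)
qed simp

lemma cauchy_schwarz_sqrt: "cmod (f x y) \<le> sqrt (Re (f x x)) * sqrt (Re (f y y))"
  using real_le_rsqrt[OF cauchy_schwarz] by (simp add: real_sqrt_mult)

lemma triangle: "sqrt (Re (f (x + y) (x + y))) \<le> sqrt (Re (f x x)) + sqrt (Re (f y y))"
proof (rule real_le_lsqrt)
  have "Re (f y x) = Re (f x y)" by (subst sym) simp
  then have "Re (f (x + y) (x + y)) = Re (f x x) + Re (f y y) + 2 * Re (f x y)"
    by (simp add: add_left add_right)
  also have "\<dots> \<le> Re (f x x) + Re (f y y) + 2 * (sqrt (Re (f x x)) * sqrt (Re (f y y)))"
    using cauchy_schwarz_sqrt[of x y] complex_Re_le_cmod[of "f x y"] by linarith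
  also have "\<dots> = (sqrt (Re (f x x)) + sqrt (Re (f y y)))\<^sup>2"
    by (simp add: power2_sum ge_zero)
  finally show "Re (f (x + y) (x + y)) \<le> (sqrt (Re (f x x)) + sqrt (Re (f y y)))\<^sup>2" .
qed (auto simp: ge_zero)

lemma sqrt_eq_zero_iff: "sqrt (Re (f x x)) = 0 \<longleftrightarrow> x = 0"
  using eq_zero_iff[of x] by (simp add: complex_eq_iff)

lemma sqrt_scaleC: "sqrt (Re (f (c *\<^sub>C x) (c *\<^sub>C x))) = cmod c * sqrt (Re (f x x))"
proof -
  have "f (c *\<^sub>C x) (c *\<^sub>C x) = (c * cnj c) * f x x"
    by (simp add: scale_left scale_right)
  also have "\<dots> = complex_of_real ((cmod c)\<^sup>2 * Re (f x x))"
    by (subst self_eq_of_real) (simp only: complex_norm_square[symmetric] of_real_mult of_real_power)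
  finally show ?thesis by (simp add: real_sqrt_mult)
qed

lemma sqrt_scaleR: "sqrt (Re (f (r *\<^sub>R x) (r *\<^sub>R x))) = \<bar>r\<bar> * sqrt (Re (f x x))"
  using sqrt_scaleC[of "complex_of_real r" x] by (simp add: scaleR_scaleC)

end

interpretation cinner: hermitian_form "cinner :: 'a::complex_inner \<Rightarrow> 'a \<Rightarrow> complex"
  by unfold_locales
    (rule cinner_commute cinner_add_left cinner_scaleC_left cinner_ge_zero | simp add: cinner_eq_zero_iff)+

lemmas cinner_add_right = cinner.add_right
lemmas cinner_scaleC_right = cinner.scale_right

lemma cinner_cauchy_schwarz: "cmod (cinner x y) \<le> norm x * norm y"
  unfolding norm_eq_sqrt_cinner by (rule cinner.cauchy_schwarz_sqrt)

lemma norm_scaleC: "norm (c *\<^sub>C x) = cmod c * norm (x::'a::complex_inner)"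
  unfolding norm_eq_sqrt_cinner by (rule cinner.sqrt_scaleC)

lemma cinner_self: "cinner x x = complex_of_real ((norm x)\<^sup>2)"
  unfolding norm_eq_sqrt_cinner by (subst cinner.self_eq_of_real) (simp add: cinner_ge_zero)

lemma norm_power2_cinner: "(norm x)\<^sup>2 = Re (cinner x x)"
  by (simp add: cinner_self del: of_real_power)

lemma bounded_bilinear_cinner: "bounded_bilinear (cinner :: 'a::complex_inner \<Rightarrow> 'a \<Rightarrow> complex)"
proof
  show "\<exists>K. \<forall>a b. cmod (cinner (a::'a) b) \<le> norm a * norm b * K"
    by (rule exI[of _ 1]) (simp add: cinner_cauchy_schwarz)
qed (auto simp: cinner_add_left cinner_add_right scaleR_scaleC cinner_scaleC_left cinner_scaleC_right scaleR_conv_of_real)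

interpretation cinner_bilinear: bounded_bilinear "cinner :: 'a::complex_inner \<Rightarrow> 'a \<Rightarrow> complex"
  by (rule bounded_bilinear_cinner)

lemma bounded_linear_scaleC: "bounded_linear ((*\<^sub>C) c :: 'a::complex_inner \<Rightarrow> 'a)"
proof
  show "\<exists>K. \<forall>x. norm (c *\<^sub>C x :: 'a) \<le> norm x * K"
    by (rule exI[of _ "cmod c"]) (simp add: norm_scaleC)
qed (simp_all only: scaleC_add_right scaleR_scaleC scaleC_scaleC mult.commute)

instantiation complex :: chilbert_space
begin
definition "scaleC_complex = ((*) :: complex \<Rightarrow> complex \<Rightarrow> complex)"
definition "cinner_complex (x::complex) y = x * cnj y"
instance
proof
  fix x y z c d :: complex and r :: real
  show "0 \<le> Re (cinner x x)" by (simp add: cinner_complex_def)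
  show "norm x = sqrt (Re (cinner x x))" by (simp add: cinner_complex_def cmod_def power2_eq_square)
  show "(cinner x x = 0) = (x = 0)" by (simp add: cinner_complex_def)
  show "c *\<^sub>C (x + y) = c *\<^sub>C x + c *\<^sub>C y" by (simp add: scaleC_complex_def distrib_left)
  show "(c + d) *\<^sub>C x = c *\<^sub>C x + d *\<^sub>C x" by (simp add: scaleC_complex_def distrib_right)
  show "c *\<^sub>C d *\<^sub>C x = (c * d) *\<^sub>C x" by (simp add: scaleC_complex_def mult.assoc)
  show "1 *\<^sub>C x = x" by (simp add: scaleC_complex_def)
  show "r *\<^sub>R x = complex_of_real r *\<^sub>C x" by (simp add: scaleC_complex_def scaleR_conv_of_real)
  show "cinner x y = cnj (cinner y x)" by (simp add: cinner_complex_def mult.commute)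
  show "cinner (x + y) z = cinner x z + cinner y z" by (simp add: cinner_complex_def distrib_right)
  show "cinner (c *\<^sub>C x) y = c * cinner x y" by (simp add: cinner_complex_def scaleC_complex_def mult.assoc)
qed
end

section \<open>The algebraic tensor product\<close>

definition free_scale :: "complex \<Rightarrow> ('k \<Rightarrow>\<^sub>0 complex) \<Rightarrow> ('k \<Rightarrow>\<^sub>0 complex)" where
  "free_scale c f = Poly_Mapping.map ((*) c) f"

abbreviation free_pair :: "'a \<Rightarrow> 'b \<Rightarrow> ('a \<times> 'b) \<Rightarrow>\<^sub>0 complex" where
  "free_pair x y \<equiv> Poly_Mapping.single (x, y) 1"

text \<open>The subspace of the free complex vector space on pairs that is generated by the bilinearity
  relations.\<close>

inductive_set tensor_rel :: "(('a::complex_vector \<times> 'b::complex_vector) \<Rightarrow>\<^sub>0 complex) set" where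
  zero: "0 \<in> tensor_rel"
| add: "f \<in> tensor_rel \<Longrightarrow> g \<in> tensor_rel \<Longrightarrow> f + g \<in> tensor_rel"
| scale: "f \<in> tensor_rel \<Longrightarrow> free_scale c f \<in> tensor_rel"
| add_left: "free_pair (x + x') y - free_pair x y - free_pair x' y \<in> tensor_rel"
| add_right: "free_pair x (y + y') - free_pair x y - free_pair x y' \<in> tensor_rel"
| scale_left: "free_pair (c *\<^sub>C x) y - free_scale c (free_pair x y) \<in> tensor_rel"
| scale_right: "free_pair x (c *\<^sub>C y) - free_scale c (free_pair x y) \<in> tensor_rel"

lemma lookup_free_scale [simp]: "Poly_Mapping.lookup (free_scale c f) k = c * Poly_Mapping.lookup f k"
  by (simp add: free_scale_def Poly_Mapping.map.rep_eq when_def)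

lemma free_scale_simps:
  "free_scale c (f + g) = free_scale c f + free_scale c g"
  "free_scale (c + d) f = free_scale c f + free_scale d f"
  "free_scale c (free_scale d f) = free_scale (c * d) f"
  "free_scale 1 f = f"
  "free_scale (-1) f = - f"
  "free_scale c (f - g) = free_scale c f - free_scale c g"
  "free_scale c (Poly_Mapping.single k d) = Poly_Mapping.single k (c * d)"
  by (rule poly_mapping_eqI, simp add: lookup_add lookup_minus lookup_single algebra_simps when_def)+

lemma tensor_rel_uminus: "f \<in> tensor_rel \<Longrightarrow> - f \<in> tensor_rel"
  using tensor_rel.scale[of f "-1"] by (simp add: free_scale_simps)

quotient_type (overloaded) ('a, 'b) atensor = "('a::complex_vector \<times> 'b::complex_vector) \<Rightarrow>\<^sub>0 complex" /
  "\<lambda>f g. f - g \<in> tensor_rel"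
  morphisms rep_atensor abs_atensor
proof (rule equivpI)
  show "reflp (\<lambda>f g :: ('a \<times> 'b) \<Rightarrow>\<^sub>0 complex. f - g \<in> tensor_rel)"
    by (simp add: reflp_def tensor_rel.zero)
  show "symp (\<lambda>f g :: ('a \<times> 'b) \<Rightarrow>\<^sub>0 complex. f - g \<in> tensor_rel)"
    by (rule sympI) (use tensor_rel_uminus in fastforce)
  show "transp (\<lambda>f g :: ('a \<times> 'b) \<Rightarrow>\<^sub>0 complex. f - g \<in> tensor_rel)"
    by (rule transpI) (use tensor_rel.add in fastforce)
qed

instantiation atensor :: (complex_vector, complex_vector) complex_vector
begin

lift_definition zero_atensor :: "('a, 'b) atensor" is 0 .

lift_definition plus_atensor :: "('a, 'b) atensor \<Rightarrow> ('a, 'b) atensor \<Rightarrow> ('a, 'b) atensor" is "(+)"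
  by (metis tensor_rel.add add_diff_add)

lift_definition uminus_atensor :: "('a, 'b) atensor \<Rightarrow> ('a, 'b) atensor" is uminus
  by (metis tensor_rel_uminus minus_diff_minus)

lift_definition minus_atensor :: "('a, 'b) atensor \<Rightarrow> ('a, 'b) atensor \<Rightarrow> ('a, 'b) atensor" is "(-)"
proof -
  fix f f' g g' :: "('a \<times> 'b) \<Rightarrow>\<^sub>0 complex"
  assume "f - f' \<in> tensor_rel" "g - g' \<in> tensor_rel"
  then have "(f - f') + - (g - g') \<in> tensor_rel" by (intro tensor_rel.add tensor_rel_uminus)
  then show "f - g - (f' - g') \<in> tensor_rel" by (simp add: algebra_simps)
qed

lift_definition scaleC_atensor :: "complex \<Rightarrow> ('a, 'b) atensor \<Rightarrow> ('a, 'b) atensor" is free_scale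
  by (metis tensor_rel.scale free_scale_simps(6))

definition scaleR_atensor :: "real \<Rightarrow> ('a, 'b) atensor \<Rightarrow> ('a, 'b) atensor" where
  "scaleR_atensor r t = complex_of_real r *\<^sub>C t"

instance
proof
  fix s t u :: "('a, 'b) atensor" and c d :: complex and q r :: real
  show "s + t + u = s + (t + u)" by transfer (simp add: add.assoc tensor_rel.zero)
  show "s + t = t + s" by transfer (simp add: add.commute tensor_rel.zero)
  show "0 + s = s" by transfer (simp add: tensor_rel.zero)
  show "- s + s = 0" by transfer (simp add: tensor_rel.zero)
  show "s - t = s + - t" by transfer (simp add: tensor_rel.zero)
  show C1: "c *\<^sub>C (s + t) = c *\<^sub>C s + c *\<^sub>C t" for c and s t :: "('a, 'b) atensor"
    by transfer (simp add: free_scale_simps tensor_rel.zero)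
  show C2: "(c + d) *\<^sub>C s = c *\<^sub>C s + d *\<^sub>C s" for c d and s :: "('a, 'b) atensor"
    by transfer (simp add: free_scale_simps tensor_rel.zero)
  show C3: "c *\<^sub>C d *\<^sub>C s = (c * d) *\<^sub>C s" for c d and s :: "('a, 'b) atensor"
    by transfer (simp add: free_scale_simps tensor_rel.zero)
  show C4: "1 *\<^sub>C s = s" for s :: "('a, 'b) atensor"
    by transfer (simp add: free_scale_simps tensor_rel.zero)
  show "r *\<^sub>R s = complex_of_real r *\<^sub>C s" by (simp add: scaleR_atensor_def)
  show "r *\<^sub>R (s + t) = r *\<^sub>R s + r *\<^sub>R t" by (simp add: scaleR_atensor_def C1)
  show "(q + r) *\<^sub>R s = q *\<^sub>R s + r *\<^sub>R s" by (simp add: scaleR_atensor_def C2)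
  show "q *\<^sub>R r *\<^sub>R s = (q * r) *\<^sub>R s" by (simp add: scaleR_atensor_def C3)
  show "1 *\<^sub>R s = s" by (simp add: scaleR_atensor_def C4)
qed

end

lift_definition atens :: "'a::complex_vector \<Rightarrow> 'b::complex_vector \<Rightarrow> ('a, 'b) atensor" is free_pair .

lemma atens_add_left: "atens (x + x') y = atens x y + atens x' y"
  by transfer (metis tensor_rel.add_left diff_diff_add)

lemma atens_add_right: "atens x (y + y') = atens x y + atens x y'"
  by transfer (metis tensor_rel.add_right diff_diff_add)

lemma atens_scaleC_left: "atens (c *\<^sub>C x) y = c *\<^sub>C atens x y"
  by transfer (rule tensor_rel.scale_left)

lemma atens_scaleC_right: "atens x (c *\<^sub>C y) = c *\<^sub>C atens x y"
  by transfer (rule tensor_rel.scale_right)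

lemma atens_zero_left [simp]: "atens 0 y = 0"
  using atens_scaleC_left[of 0 0 y] by simp

lemma atens_zero_right [simp]: "atens x 0 = 0"
  using atens_scaleC_right[of x 0 0] by simp

lemma atens_sum_left: "atens (\<Sum>i\<in>I. x i) y = (\<Sum>i\<in>I. atens (x i) y)"
  by (induction I rule: infinite_finite_induct) (auto simp: atens_add_left)

subsection \<open>Linear extension of bilinear maps\<close>

definition free_extend :: "('k \<Rightarrow> 'v::complex_vector) \<Rightarrow> ('k \<Rightarrow>\<^sub>0 complex) \<Rightarrow> 'v" where
  "free_extend h f = (\<Sum>k\<in>Poly_Mapping.keys f. Poly_Mapping.lookup f k *\<^sub>C h k)"

lemma free_extend_superset:
  assumes "finite S" "Poly_Mapping.keys f \<subseteq> S"
  shows "free_extend h f = (\<Sum>k\<in>S. Poly_Mapping.lookup f k *\<^sub>C h k)"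
  unfolding free_extend_def
  by (rule sum.mono_neutral_left) (use assms in \<open>auto simp: in_keys_iff\<close>)

lemma free_extend_add: "free_extend h (f + g) = free_extend h f + free_extend h g"
proof -
  let ?S = "Poly_Mapping.keys f \<union> Poly_Mapping.keys g"
  have "free_extend h (f + g) = (\<Sum>k\<in>?S. Poly_Mapping.lookup (f + g) k *\<^sub>C h k)"
    by (rule free_extend_superset) (use Poly_Mapping.keys_add[of f g] in auto)
  also have "\<dots> = free_extend h f + free_extend h g"
    by (simp add: free_extend_superset[of ?S f] free_extend_superset[of ?S g]
        lookup_add scaleC_add_left sum.distrib)
  finally show ?thesis .
qed

lemma free_extend_scale: "free_extend h (free_scale c f) = c *\<^sub>C free_extend h f"
proof -
  have "free_extend h (free_scale c f) =
      (\<Sum>k\<in>Poly_Mapping.keys f. Poly_Mapping.lookup (free_scale c f) k *\<^sub>C h k)"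
    by (rule free_extend_superset) (auto simp: in_keys_iff)
  then show ?thesis by (simp add: free_extend_def scaleC_sum_right scaleC_scaleC)
qed

lemma free_extend_diff: "free_extend h (f - g) = free_extend h f - free_extend h g"
  using free_extend_add[of h f "free_scale (-1) g"] free_extend_scale[of h "-1" g]
  by (simp add: free_scale_simps)

lemma free_extend_single [simp]: "free_extend h (Poly_Mapping.single k c) = c *\<^sub>C h k"
  by (simp add: free_extend_superset[of "{k}"])

lemma free_extend_zero [simp]: "free_extend h 0 = 0"
  by (simp add: free_extend_def)

definition cbilinear :: "('a::complex_vector \<Rightarrow> 'b::complex_vector \<Rightarrow> 'v::complex_vector) \<Rightarrow> bool" where
  "cbilinear h \<longleftrightarrow>
    (\<forall>x x' y. h (x + x') y = h x y + h x' y) \<and> (\<forall>x y y'. h x (y + y') = h x y + h x y') \<and>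
    (\<forall>c x y. h (c *\<^sub>C x) y = c *\<^sub>C h x y) \<and> (\<forall>c x y. h x (c *\<^sub>C y) = c *\<^sub>C h x y)"

lemma free_extend_tensor_rel:
  assumes "cbilinear h" "f \<in> tensor_rel"
  shows "free_extend (\<lambda>(x, y). h x y) f = 0"
  using assms(2,1)
  by induction (auto simp: free_extend_add free_extend_scale free_extend_diff scaleC_one cbilinear_def)

definition atensor_extend ::
  "('a::complex_vector \<Rightarrow> 'b::complex_vector \<Rightarrow> 'v::complex_vector) \<Rightarrow> ('a, 'b) atensor \<Rightarrow> 'v" where
  "atensor_extend h t = free_extend (\<lambda>(x, y). h x y) (rep_atensor t)"

lemma atensor_extend_abs:
  assumes "cbilinear h"
  shows "atensor_extend h (abs_atensor f) = free_extend (\<lambda>(x, y). h x y) f"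
proof -
  have "rep_atensor (abs_atensor f) - f \<in> tensor_rel"
    unfolding atensor.abs_eq_iff[symmetric] by (rule Quotient3_abs_rep[OF Quotient3_atensor])
  from free_extend_tensor_rel[OF assms this] show ?thesis
    by (simp add: atensor_extend_def free_extend_diff)
qed

lemma atensor_extend_atens:
  "cbilinear h \<Longrightarrow> atensor_extend h (atens x y) = h x y"
  by (simp add: atens.abs_eq atensor_extend_abs scaleC_one)

lemma atensor_extend_add:
  assumes "cbilinear h"
  shows "atensor_extend h (s + t) = atensor_extend h s + atensor_extend h t"
  by (induction s; induction t)
    (simp add: plus_atensor.abs_eq atensor_extend_abs[OF assms] free_extend_add)

lemma atensor_extend_scaleC:
  assumes "cbilinear h"
  shows "atensor_extend h (c *\<^sub>C s) = c *\<^sub>C atensor_extend h s"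
  by (induction s) (simp add: scaleC_atensor.abs_eq atensor_extend_abs[OF assms] free_extend_scale)

lemma atensor_induct [case_names zero add]:
  assumes "P 0" and step: "\<And>x y t. P t \<Longrightarrow> P (atens x y + t)"
  shows "P t"
proof (induction t rule: atensor.abs_induct)
  case (1 f)
  show ?case
  proof (induction f rule: update_induct)
    case const
    then show ?case using assms(1) by (simp add: zero_atensor.abs_eq)
  next
    case (update f k c)
    obtain x y where k: "k = (x, y)" by (cases k)
    have "Poly_Mapping.update k c f = Poly_Mapping.single k c + f"
      by (rule poly_mapping_eqI)
        (use update in \<open>auto simp: lookup_update lookup_add lookup_single when_def in_keys_iff\<close>)
    then have "Poly_Mapping.update k c f = free_scale c (free_pair x y) + f"
      by (simp add: k free_scale_simps)
    then have "abs_atensor (Poly_Mapping.update k c f) = atens (c *\<^sub>C x) y + abs_atensor f"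
      by (simp add: plus_atensor.abs_eq[symmetric] scaleC_atensor.abs_eq[symmetric]
          atens.abs_eq[symmetric] atens_scaleC_left)
    then show ?case using step update by simp
  qed
qed

subsection \<open>Inner product on the algebraic tensor product\<close>

text \<open>The sesquilinear form on formal combinations with
  \<open>\<langle>(x, y), (z, u)\<rangle> = \<langle>x, z\<rangle> \<langle>y, u\<rangle>\<close>.\<close>

definition free_cinner ::
  "(('a::complex_inner \<times> 'b::complex_inner) \<Rightarrow>\<^sub>0 complex) \<Rightarrow> (('a \<times> 'b) \<Rightarrow>\<^sub>0 complex) \<Rightarrow> complex" where
  "free_cinner f g = (\<Sum>(x, y)\<in>Poly_Mapping.keys f. \<Sum>(z, u)\<in>Poly_Mapping.keys g.
     Poly_Mapping.lookup f (x, y) * cnj (Poly_Mapping.lookup g (z, u)) * (cinner x z * cinner y u))"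

lemma free_cinner_commute: "free_cinner f g = cnj (free_cinner g f)"
proof -
  have "cnj (free_cinner g f) = (\<Sum>(x, y)\<in>Poly_Mapping.keys g. \<Sum>(z, u)\<in>Poly_Mapping.keys f.
     Poly_Mapping.lookup f (z, u) * cnj (Poly_Mapping.lookup g (x, y)) * (cinner z x * cinner u y))"
    unfolding free_cinner_def
    by (simp add: case_prod_unfold cnj_sum cinner_commute[symmetric] ac_simps)
  also have "\<dots> = free_cinner f g"
    unfolding free_cinner_def case_prod_unfold by (rule sum.swap)
  finally show ?thesis by simp
qed

lemma free_cinner_extend:
  "free_cinner f g = free_extend (\<lambda>(x, y). cnj (free_extend (\<lambda>(z, u). cinner z x * cinner u y) g)) f"
  unfolding free_cinner_def free_extend_def
  by (simp add: case_prod_unfold cnj_sum sum_distrib_left scaleC_complex_def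
      cinner_commute[symmetric] ac_simps)

lemma free_extend_fun_add: "free_extend (\<lambda>k. h k + h' k) f = free_extend h f + free_extend h' f"
  by (simp add: free_extend_def scaleC_add_right sum.distrib)

lemma free_extend_fun_scaleC: "free_extend (\<lambda>k. c *\<^sub>C h k) f = c *\<^sub>C free_extend h f"
  by (simp add: free_extend_def scaleC_sum_right scaleC_scaleC mult.commute)

lemma cbilinear_free_cinner:
  "cbilinear (\<lambda>x y. cnj (free_extend (\<lambda>(z, u). cinner z x * cinner u y) g))"
proof -
  have 1: "free_extend (\<lambda>(z, u). cinner z (x + x') * cinner u y) g =
      free_extend (\<lambda>(z, u). cinner z x * cinner u y) g + free_extend (\<lambda>(z, u). cinner z x' * cinner u y) g"
    for x x' y
    by (subst free_extend_fun_add[symmetric]) (simp add: case_prod_unfold cinner_add_right algebra_simps)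
  have 2: "free_extend (\<lambda>(z, u). cinner z x * cinner u (y + y')) g =
      free_extend (\<lambda>(z, u). cinner z x * cinner u y) g + free_extend (\<lambda>(z, u). cinner z x * cinner u y') g"
    for x y y'
    by (subst free_extend_fun_add[symmetric]) (simp add: case_prod_unfold cinner_add_right algebra_simps)
  have 3: "free_extend (\<lambda>(z, u). cinner z (c *\<^sub>C x) * cinner u y) g =
      cnj c * free_extend (\<lambda>(z, u). cinner z x * cinner u y) g" for c x y
    using free_extend_fun_scaleC[of "cnj c" "\<lambda>(z, u). cinner z x * cinner u y" g]
    by (simp add: case_prod_unfold cinner_scaleC_right scaleC_complex_def algebra_simps)
  have 4: "free_extend (\<lambda>(z, u). cinner z x * cinner u (c *\<^sub>C y)) g =
      cnj c * free_extend (\<lambda>(z, u). cinner z x * cinner u y) g" for c x y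
    using free_extend_fun_scaleC[of "cnj c" "\<lambda>(z, u). cinner z x * cinner u y" g]
    by (simp add: case_prod_unfold cinner_scaleC_right scaleC_complex_def algebra_simps)
  show ?thesis unfolding cbilinear_def by (simp add: 1 2 3 4 scaleC_complex_def)
qed

lemma free_cinner_add_left: "free_cinner (f + f') g = free_cinner f g + free_cinner f' g"
  by (simp add: free_cinner_extend free_extend_add)

lemma free_cinner_scale_left: "free_cinner (free_scale c f) g = c * free_cinner f g"
  by (simp add: free_cinner_extend free_extend_scale scaleC_complex_def)

lemma free_cinner_cong_left:
  assumes "f - f' \<in> tensor_rel"
  shows "free_cinner f g = free_cinner f' g"
  using free_extend_tensor_rel[OF cbilinear_free_cinner assms, of g]
  by (simp add: free_cinner_extend free_extend_diff)

lemma free_cinner_cong: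
  assumes "f - f' \<in> tensor_rel" "g - g' \<in> tensor_rel"
  shows "free_cinner f g = free_cinner f' g'"
  by (metis assms free_cinner_cong_left free_cinner_commute)

lift_definition atensor_cinner ::
  "('a::complex_inner, 'b::complex_inner) atensor \<Rightarrow> ('a, 'b) atensor \<Rightarrow> complex" is free_cinner
  by (rule free_cinner_cong)

lemma atensor_cinner_atens: "atensor_cinner (atens x y) (atens z u) = cinner x z * cinner y u"
  by transfer (simp add: free_cinner_extend scaleC_complex_def cinner_commute[symmetric])

lemma atensor_cinner_commute: "atensor_cinner s t = cnj (atensor_cinner t s)"
  by transfer (rule free_cinner_commute)

lemma atensor_cinner_add_left: "atensor_cinner (s + s') t = atensor_cinner s t + atensor_cinner s' t"
  by transfer (rule free_cinner_add_left)

lemma atensor_cinner_scaleC_left: "atensor_cinner (c *\<^sub>C s) t = c * atensor_cinner s t"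
  by transfer (rule free_cinner_scale_left)

lemma atensor_cinner_sum_left: "atensor_cinner (\<Sum>i\<in>I. s i) t = (\<Sum>i\<in>I. atensor_cinner (s i) t)"
  by (induction I rule: infinite_finite_induct)
    (use atensor_cinner_scaleC_left[of 0 0 t] in \<open>auto simp: atensor_cinner_add_left\<close>)

lemma atensor_cinner_sum_right: "atensor_cinner t (\<Sum>i\<in>I. s i) = (\<Sum>i\<in>I. atensor_cinner t (s i))"
  by (subst atensor_cinner_commute) (simp add: atensor_cinner_sum_left atensor_cinner_commute[symmetric])

definition orthonormal :: "'a::complex_inner set \<Rightarrow> bool" where
  "orthonormal E \<longleftrightarrow> (\<forall>e\<in>E. \<forall>e'\<in>E. cinner e e' = (if e = e' then 1 else 0))"

lemma atensor_orthonormal: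
  fixes t :: "('a::complex_inner, 'b::complex_vector) atensor"
  obtains E y where "finite E" "orthonormal E" "t = (\<Sum>e\<in>E. atens e (y e))"
proof -
  have "\<exists>E y. finite E \<and> orthonormal E \<and> t = (\<Sum>e\<in>E. atens e (y e))"
  proof (induction t rule: atensor_induct)
    case zero
    show ?case by (rule exI[of _ "{}"]) (simp add: orthonormal_def)
  next
    case (add x z t)
    then obtain E y where E: "finite E" "orthonormal E" and t: "t = (\<Sum>e\<in>E. atens e (y e))" by blast
    define r where "r = x - (\<Sum>e\<in>E. cinner x e *\<^sub>C e)"
    define y1 where "y1 e = y e + cinner x e *\<^sub>C z" for e
    have x: "x = (\<Sum>e\<in>E. cinner x e *\<^sub>C e) + r" by (simp add: r_def)
    have "atens x z = (\<Sum>e\<in>E. atens e (cinner x e *\<^sub>C z)) + atens r z"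
      by (subst x) (simp add: atens_add_left atens_sum_left atens_scaleC_left atens_scaleC_right)
    then have t1: "atens x z + t = (\<Sum>e\<in>E. atens e (y1 e)) + atens r z"
      by (simp add: t y1_def atens_add_right sum.distrib algebra_simps)
    have r: "cinner r e = 0" if "e \<in> E" for e
    proof -
      have "cinner (\<Sum>e'\<in>E. cinner x e' *\<^sub>C e') e = (\<Sum>e'\<in>E. if e' = e then cinner x e else 0)"
        unfolding cinner_bilinear.sum_left
        by (rule sum.cong) (use E(2) that in \<open>auto simp: cinner_scaleC_left orthonormal_def\<close>)
      then show ?thesis using E(1) that by (simp add: r_def cinner_bilinear.diff_left)
    qed
    show ?case
    proof (cases "r = 0")
      case True
      then show ?thesis using t1 E by auto
    next
      case False
      define e0 where "e0 = complex_of_real (inverse (norm r)) *\<^sub>C r"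
      define y2 where "y2 = y1(e0 := complex_of_real (norm r) *\<^sub>C z)"
      have e0: "cinner e0 e = 0" "cinner e e0 = 0" if "e \<in> E" for e
        using r[OF that] cinner_commute[of e e0] by (auto simp: e0_def cinner_scaleC_left)
      have e0e0: "cinner e0 e0 = 1"
        using False by (simp add: cinner_self e0_def norm_scaleC norm_inverse)
      have nE: "e0 \<notin> E" using e0 e0e0 by auto
      have "atens e0 (y2 e0) = atens r z"
        using False by (simp add: e0_def y2_def atens_scaleC_left atens_scaleC_right scaleC_scaleC scaleC_one)
      moreover have "(\<Sum>e\<in>E. atens e (y2 e)) = (\<Sum>e\<in>E. atens e (y1 e))"
        by (rule sum.cong) (use nE in \<open>auto simp: y2_def\<close>)
      ultimately have "atens x z + t = (\<Sum>e\<in>insert e0 E. atens e (y2 e))"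
        using E(1) nE t1 by (simp add: add.commute)
      moreover have "orthonormal (insert e0 E)"
        using E(2) e0 e0e0 nE by (auto simp: orthonormal_def)
      ultimately show ?thesis using E(1) by blast
    qed
  qed
  then show ?thesis using that by blast
qed

lemma atensor_cinner_orthonormal:
  assumes "finite E" "orthonormal E"
  shows "atensor_cinner (\<Sum>e\<in>E. atens e (y e)) (\<Sum>e\<in>E. atens e (y' e)) = (\<Sum>e\<in>E. cinner (y e) (y' e))"
proof -
  have "atensor_cinner (\<Sum>e\<in>E. atens e (y e)) (\<Sum>e\<in>E. atens e (y' e)) =
      (\<Sum>e\<in>E. \<Sum>e'\<in>E. cinner e e' * cinner (y e) (y' e'))"
    by (simp only: atensor_cinner_sum_left) (simp only: atensor_cinner_sum_right atensor_cinner_atens)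
  also have "\<dots> = (\<Sum>e\<in>E. \<Sum>e'\<in>E. if e = e' then cinner (y e) (y' e') else 0)"
    by (intro sum.cong) (use assms in \<open>auto simp: orthonormal_def\<close>)
  finally show ?thesis using assms by simp
qed

interpretation atensor: hermitian_form
  "atensor_cinner :: ('a::complex_inner, 'b::complex_inner) atensor \<Rightarrow> _"
proof
  fix s t u :: "('a, 'b) atensor" and c
  show "atensor_cinner s t = cnj (atensor_cinner t s)" by (rule atensor_cinner_commute)
  show "atensor_cinner (s + t) u = atensor_cinner s u + atensor_cinner t u"
    by (rule atensor_cinner_add_left)
  show "atensor_cinner (c *\<^sub>C s) t = c * atensor_cinner s t" by (rule atensor_cinner_scaleC_left)
  obtain E y where E: "finite E" "orthonormal E" and s: "s = (\<Sum>e\<in>E. atens e (y e))"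
    by (rule atensor_orthonormal)
  have eq: "Re (atensor_cinner s s) = (\<Sum>e\<in>E. (norm (y e))\<^sup>2)"
    unfolding s atensor_cinner_orthonormal[OF E] by (simp add: norm_power2_cinner)
  show "0 \<le> Re (atensor_cinner s s)" unfolding eq by (simp add: sum_nonneg)
  show "s = 0" if "atensor_cinner s s = 0"
  proof -
    have "(\<Sum>e\<in>E. (norm (y e))\<^sup>2) = 0" using that eq by simp
    then have "\<forall>e\<in>E. y e = 0" using E(1) by (simp add: sum_nonneg_eq_0_iff)
    then show ?thesis by (simp add: s)
  qed
qed

instantiation atensor :: (complex_inner, complex_inner) complex_inner
begin

definition cinner_atensor :: "('a, 'b) atensor \<Rightarrow> ('a, 'b) atensor \<Rightarrow> complex" where
  "cinner_atensor = atensor_cinner"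
definition norm_atensor :: "('a, 'b) atensor \<Rightarrow> real" where
  "norm_atensor t = sqrt (Re (cinner t t))"
definition sgn_atensor :: "('a, 'b) atensor \<Rightarrow> ('a, 'b) atensor" where
  "sgn_atensor t = t /\<^sub>R norm t"
definition dist_atensor :: "('a, 'b) atensor \<Rightarrow> ('a, 'b) atensor \<Rightarrow> real" where
  "dist_atensor s t = norm (s - t)"
definition uniformity_atensor :: "(('a, 'b) atensor \<times> ('a, 'b) atensor) filter" where
  "uniformity_atensor = (INF e\<in>{0<..}. principal {(x, y). dist x y < e})"
definition open_atensor :: "('a, 'b) atensor set \<Rightarrow> bool" where
  "open_atensor U \<longleftrightarrow> (\<forall>x\<in>U. \<forall>\<^sub>F (x', y) in uniformity. x' = x \<longrightarrow> y \<in> U)"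

instance
proof
  fix s t u :: "('a, 'b) atensor" and c :: complex and r :: real and U :: "('a, 'b) atensor set"
  show "dist s t = norm (s - t)" by (rule dist_atensor_def)
  show "sgn s = s /\<^sub>R norm s" by (rule sgn_atensor_def)
  show "(uniformity :: (('a, 'b) atensor \<times> _) filter) = (INF e\<in>{0<..}. principal {(x, y). dist x y < e})"
    by (rule uniformity_atensor_def)
  show "open U = (\<forall>x\<in>U. \<forall>\<^sub>F (x', y) in uniformity. x' = x \<longrightarrow> y \<in> U)" by (rule open_atensor_def)
  show "(norm s = 0) = (s = 0)"
    unfolding norm_atensor_def cinner_atensor_def by (rule atensor.sqrt_eq_zero_iff)
  show "norm (s + t) \<le> norm s + norm t"
    unfolding norm_atensor_def cinner_atensor_def by (rule atensor.triangle)
  show "norm (r *\<^sub>R s) = \<bar>r\<bar> * norm s"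
    unfolding norm_atensor_def cinner_atensor_def by (rule atensor.sqrt_scaleR)
  show "cinner s t = cnj (cinner t s)" unfolding cinner_atensor_def by (rule atensor.sym)
  show "cinner (s + t) u = cinner s u + cinner t u" unfolding cinner_atensor_def by (rule atensor.add_left)
  show "cinner (c *\<^sub>C s) t = c * cinner s t" unfolding cinner_atensor_def by (rule atensor.scale_left)
  show "0 \<le> Re (cinner s s)" unfolding cinner_atensor_def by (rule atensor.ge_zero)
  show "(cinner s s = 0) = (s = 0)" unfolding cinner_atensor_def by (rule atensor.eq_zero_iff)
  show "norm s = sqrt (Re (cinner s s))" by (rule norm_atensor_def)
qed

end

lemma cinner_atens: "cinner (atens x y) (atens z u) = cinner x z * cinner y u"
  by (simp add: cinner_atensor_def atensor_cinner_atens)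

section \<open>Hilbert space completion\<close>

lemma Cauchy_add:
  fixes X Y :: "nat \<Rightarrow> 'a::real_normed_vector"
  assumes "Cauchy X" "Cauchy Y"
  shows "Cauchy (\<lambda>n. X n + Y n)"
proof -
  have "bounded_linear (\<lambda>p::'a \<times> 'a. fst p + snd p)"
    by (intro bounded_linear_add bounded_linear_fst bounded_linear_snd)
  from bounded_linear.Cauchy[OF this Cauchy_Pair[OF assms]] show ?thesis by simp
qed

lemma Cauchy_uminus: "Cauchy X \<Longrightarrow> Cauchy (\<lambda>n. - X n :: 'a::real_normed_vector)"
  by (rule bounded_linear.Cauchy[OF bounded_linear_minus[OF bounded_linear_ident]])

lemma Cauchy_diff:
  fixes X Y :: "nat \<Rightarrow> 'a::real_normed_vector"
  shows "Cauchy X \<Longrightarrow> Cauchy Y \<Longrightarrow> Cauchy (\<lambda>n. X n - Y n)"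
  using Cauchy_add[OF _ Cauchy_uminus, of X Y] by simp

lemma Cauchy_scaleC: "Cauchy X \<Longrightarrow> Cauchy (\<lambda>n. c *\<^sub>C X n :: 'a::complex_inner)"
  by (rule bounded_linear.Cauchy[OF bounded_linear_scaleC])

lemma tendsto_cinner_null_left:
  fixes Z Y :: "nat \<Rightarrow> 'a::complex_inner"
  assumes "Z \<longlonglongrightarrow> 0" "Cauchy Y"
  shows "(\<lambda>n. cinner (Z n) (Y n)) \<longlonglongrightarrow> 0"
proof -
  have "Zfun Z sequentially" using assms(1) by (simp add: tendsto_Zfun_iff)
  moreover have "Bfun Y sequentially" using Cauchy_Bseq[OF assms(2)] .
  ultimately show ?thesis
    using bounded_bilinear.Zfun_prod_Bfun[OF bounded_bilinear_cinner] by (simp add: tendsto_Zfun_iff)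
qed

lemma tendsto_cinner_null_right:
  fixes Z Y :: "nat \<Rightarrow> 'a::complex_inner"
  assumes "Z \<longlonglongrightarrow> 0" "Cauchy Y"
  shows "(\<lambda>n. cinner (Y n) (Z n)) \<longlonglongrightarrow> 0"
  using tendsto_cnj[OF tendsto_cinner_null_left[OF assms]] by (simp add: cinner_commute[symmetric])

lemma Cauchy_cinner:
  fixes X Y :: "nat \<Rightarrow> 'a::complex_inner"
  assumes "Cauchy X" "Cauchy Y"
  shows "Cauchy (\<lambda>n. cinner (X n) (Y n))"
proof (rule CauchyI)
  fix e :: real
  assume e: "0 < e"
  obtain K where K: "K > 0" "\<And>n. norm (X n) \<le> K" "\<And>n. norm (Y n) \<le> K"
  proof -
    obtain K1 where "K1 > 0" "\<forall>n. norm (X n) \<le> K1" using Cauchy_Bseq[OF assms(1)] by (rule BseqE)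
    moreover obtain K2 where "K2 > 0" "\<forall>n. norm (Y n) \<le> K2" using Cauchy_Bseq[OF assms(2)] by (rule BseqE)
    ultimately show ?thesis by (intro that[of "max K1 K2"]) (auto simp: le_max_iff_disj)
  qed
  have e': "0 < e / (2 * K)" using e K(1) by simp
  obtain M1 where M1: "\<And>m n. m \<ge> M1 \<Longrightarrow> n \<ge> M1 \<Longrightarrow> norm (X m - X n) < e / (2 * K)"
    using CauchyD[OF assms(1) e'] by blast
  obtain M2 where M2: "\<And>m n. m \<ge> M2 \<Longrightarrow> n \<ge> M2 \<Longrightarrow> norm (Y m - Y n) < e / (2 * K)"
    using CauchyD[OF assms(2) e'] by blast
  have "norm (cinner (X m) (Y m) - cinner (X n) (Y n)) < e" if "m \<ge> max M1 M2" "n \<ge> max M1 M2" for m n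
  proof -
    have "cinner (X m) (Y m) - cinner (X n) (Y n) = cinner (X m - X n) (Y m) + cinner (X n) (Y m - Y n)"
      by (simp add: cinner_bilinear.diff_left cinner_bilinear.diff_right)
    then have "norm (cinner (X m) (Y m) - cinner (X n) (Y n)) \<le>
        norm (X m - X n) * norm (Y m) + norm (X n) * norm (Y m - Y n)"
      by (metis norm_triangle_le add_mono cinner_cauchy_schwarz)
    also have "\<dots> \<le> norm (X m - X n) * K + K * norm (Y m - Y n)"
      by (intro add_mono mult_left_mono mult_right_mono K) auto
    also have "\<dots> < (e / (2 * K)) * K + K * (e / (2 * K))"
      by (intro add_strict_mono mult_strict_right_mono mult_strict_left_mono M1 M2 K) (use that in auto)
    finally show ?thesis using K(1) by simp
  qed
  then show "\<exists>M. \<forall>m\<ge>M. \<forall>n\<ge>M. norm (cinner (X m) (Y m) - cinner (X n) (Y n)) < e" by blast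
qed

definition completion_rel :: "(nat \<Rightarrow> 'a::complex_inner) \<Rightarrow> (nat \<Rightarrow> 'a) \<Rightarrow> bool" where
  "completion_rel X Y \<longleftrightarrow> Cauchy X \<and> Cauchy Y \<and> (\<lambda>n. X n - Y n) \<longlonglongrightarrow> 0"

lemma completion_rel_refl [simp]: "completion_rel X X \<longleftrightarrow> Cauchy X"
  by (simp add: completion_rel_def)

quotient_type (overloaded) 'a completion = "nat \<Rightarrow> 'a::complex_inner" / partial: completion_rel
  morphisms rep_completion abs_completion
proof (rule part_equivpI)
  show "\<exists>X::nat \<Rightarrow> 'a. completion_rel X X"
    by (rule exI[of _ "\<lambda>_. 0"]) (simp add: convergent_Cauchy convergent_const)
  show "symp (completion_rel :: (nat \<Rightarrow> 'a) \<Rightarrow> _)"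
    by (rule sympI) (auto simp: completion_rel_def dest: tendsto_minus)
  show "transp (completion_rel :: (nat \<Rightarrow> 'a) \<Rightarrow> _)"
  proof (rule transpI)
    fix X Y Z :: "nat \<Rightarrow> 'a"
    assume "completion_rel X Y" "completion_rel Y Z"
    then show "completion_rel X Z"
      using tendsto_add[of "\<lambda>n. X n - Y n" 0 sequentially "\<lambda>n. Y n - Z n" 0]
      by (simp add: completion_rel_def)
  qed
qed

lemma completion_rel_lim:
  assumes "completion_rel X X'" "completion_rel Y Y'"
  shows "lim (\<lambda>n. cinner (X n) (Y n)) = lim (\<lambda>n. cinner (X' n) (Y' n))"
proof -
  have C: "Cauchy X" "Cauchy Y" "Cauchy X'" "Cauchy Y'"
    and null: "(\<lambda>n. X n - X' n) \<longlonglongrightarrow> 0" "(\<lambda>n. Y n - Y' n) \<longlonglongrightarrow> 0"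
    using assms by (auto simp: completion_rel_def)
  have "(\<lambda>n. cinner (X n - X' n) (Y n) + cinner (X' n) (Y n - Y' n)) \<longlonglongrightarrow> 0 + 0"
    by (intro tendsto_add tendsto_cinner_null_left tendsto_cinner_null_right null C)
  then have d: "(\<lambda>n. cinner (X n) (Y n) - cinner (X' n) (Y' n)) \<longlonglongrightarrow> 0"
    by (simp add: cinner_bilinear.diff_left cinner_bilinear.diff_right)
  have "(\<lambda>n. cinner (X' n) (Y' n)) \<longlonglongrightarrow> lim (\<lambda>n. cinner (X' n) (Y' n))"
    using Cauchy_cinner[OF C(3,4)] by (simp add: Cauchy_convergent_iff convergent_LIMSEQ_iff)
  from tendsto_add[OF d this] show ?thesis by (auto intro: limI)
qed

lemma completion_induct [case_names Cauchy]:
  "(\<And>X. Cauchy X \<Longrightarrow> P (abs_completion X)) \<Longrightarrow> P u"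
  by (induction u rule: completion.abs_induct) simp

lemma Cauchy_const: "Cauchy (\<lambda>_::nat. x :: 'a::real_normed_vector)"
  by (simp add: convergent_Cauchy convergent_const)

instantiation completion :: (complex_inner) complex_vector
begin

lift_definition zero_completion :: "'a completion" is "\<lambda>_. 0"
  by (simp add: convergent_Cauchy convergent_const)

lift_definition plus_completion :: "'a completion \<Rightarrow> 'a completion \<Rightarrow> 'a completion"
  is "\<lambda>X Y n. X n + Y n"
proof -
  fix X X' Y Y' :: "nat \<Rightarrow> 'a"
  assume "completion_rel X X'" "completion_rel Y Y'"
  then show "completion_rel (\<lambda>n. X n + Y n) (\<lambda>n. X' n + Y' n)"
    using tendsto_add[of "\<lambda>n. X n - X' n" 0 sequentially "\<lambda>n. Y n - Y' n" 0]
    by (simp add: completion_rel_def Cauchy_add algebra_simps)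
qed

lift_definition uminus_completion :: "'a completion \<Rightarrow> 'a completion" is "\<lambda>X n. - X n"
  by (auto simp: completion_rel_def Cauchy_uminus add.commute dest: tendsto_minus)

definition minus_completion :: "'a completion \<Rightarrow> 'a completion \<Rightarrow> 'a completion" where
  "minus_completion u v = u + - v"

lift_definition scaleC_completion :: "complex \<Rightarrow> 'a completion \<Rightarrow> 'a completion" is "\<lambda>c X n. c *\<^sub>C X n"
proof -
  fix c and X X' :: "nat \<Rightarrow> 'a"
  assume "completion_rel X X'"
  then show "completion_rel (\<lambda>n. c *\<^sub>C X n) (\<lambda>n. c *\<^sub>C X' n)"
    using bounded_linear.tendsto[OF bounded_linear_scaleC, of "\<lambda>n. X n - X' n" 0 sequentially c]
    by (simp add: completion_rel_def Cauchy_scaleC bounded_linear.linear[OF bounded_linear_scaleC] linear_diff)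
qed

definition scaleR_completion :: "real \<Rightarrow> 'a completion \<Rightarrow> 'a completion" where
  "scaleR_completion r u = complex_of_real r *\<^sub>C u"

instance
proof
  fix s t u :: "'a completion" and c d :: complex and q r :: real
  have add: "abs_completion X + abs_completion Y = abs_completion (\<lambda>n. X n + Y n)"
    if "Cauchy X" "Cauchy Y" for X Y :: "nat \<Rightarrow> 'a"
    using that by (simp add: plus_completion.abs_eq)
  have scale: "c *\<^sub>C abs_completion X = abs_completion (\<lambda>n. c *\<^sub>C X n)"
    if "Cauchy X" for c and X :: "nat \<Rightarrow> 'a"
    using that by (simp add: scaleC_completion.abs_eq)
  show C1: "c *\<^sub>C (s + t) = c *\<^sub>C s + c *\<^sub>C t" for c and s t :: "'a completion"
    by (induction s rule: completion_induct; induction t rule: completion_induct)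
      (simp add: add scale Cauchy_add Cauchy_scaleC scaleC_add_right)
  show C2: "(c + d) *\<^sub>C s = c *\<^sub>C s + d *\<^sub>C s" for c d and s :: "'a completion"
    by (induction s rule: completion_induct) (simp add: add scale Cauchy_scaleC scaleC_add_left)
  show C3: "c *\<^sub>C d *\<^sub>C s = (c * d) *\<^sub>C s" for c d and s :: "'a completion"
    by (induction s rule: completion_induct) (simp add: scale Cauchy_scaleC scaleC_scaleC)
  show C4: "1 *\<^sub>C s = s" for s :: "'a completion"
    by (induction s rule: completion_induct) (simp add: scale scaleC_one)
  show "s + t + u = s + (t + u)"
    by (induction s rule: completion_induct; induction t rule: completion_induct;
        induction u rule: completion_induct) (simp add: add Cauchy_add add.assoc)
  show "s + t = t + s"
    by (induction s rule: completion_induct; induction t rule: completion_induct)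
      (simp add: add add.commute)
  show "0 + s = s"
    by (induction s rule: completion_induct) (simp add: zero_completion_def add Cauchy_const)
  show "- s + s = 0"
    by (induction s rule: completion_induct)
      (simp add: zero_completion_def uminus_completion.abs_eq add Cauchy_uminus)
  show "s - t = s + - t" by (rule minus_completion_def)
  show "r *\<^sub>R s = complex_of_real r *\<^sub>C s" by (rule scaleR_completion_def)
  show "r *\<^sub>R (s + t) = r *\<^sub>R s + r *\<^sub>R t" by (simp add: scaleR_completion_def C1)
  show "(q + r) *\<^sub>R s = q *\<^sub>R s + r *\<^sub>R s" by (simp add: scaleR_completion_def C2)
  show "q *\<^sub>R r *\<^sub>R s = (q * r) *\<^sub>R s" by (simp add: scaleR_completion_def C3)
  show "1 *\<^sub>R s = s" by (simp add: scaleR_completion_def C4)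
qed

end

lemma abs_completion_add:
  "Cauchy X \<Longrightarrow> Cauchy Y \<Longrightarrow> abs_completion X + abs_completion Y = abs_completion (\<lambda>n. X n + Y n)"
  by (simp add: plus_completion.abs_eq)

lemma abs_completion_scaleC:
  "Cauchy X \<Longrightarrow> c *\<^sub>C abs_completion X = abs_completion (\<lambda>n. c *\<^sub>C X n)"
  by (simp add: scaleC_completion.abs_eq)

lemma abs_completion_diff:
  "Cauchy X \<Longrightarrow> Cauchy Y \<Longrightarrow> abs_completion X - abs_completion Y = abs_completion (\<lambda>n. X n - Y n)"
  by (simp add: minus_completion_def uminus_completion.abs_eq abs_completion_add Cauchy_uminus)

lift_definition completion_cinner :: "'a::complex_inner completion \<Rightarrow> 'a completion \<Rightarrow> complex"
  is "\<lambda>X Y. lim (\<lambda>n. cinner (X n) (Y n))"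
  by (rule completion_rel_lim)

lemma LIMSEQ_completion_cinner:
  assumes "Cauchy X" "Cauchy Y"
  shows "(\<lambda>n. cinner (X n) (Y n)) \<longlonglongrightarrow> completion_cinner (abs_completion X) (abs_completion Y)"
  using Cauchy_cinner[OF assms]
  by (simp add: completion_cinner.abs_eq assms Cauchy_convergent_iff convergent_LIMSEQ_iff)

interpretation completion: hermitian_form "completion_cinner :: 'a::complex_inner completion \<Rightarrow> _"
proof
  fix s t u :: "'a completion" and c
  show "completion_cinner s t = cnj (completion_cinner t s)"
  proof (induction s rule: completion_induct; induction t rule: completion_induct)
    fix X Y :: "nat \<Rightarrow> 'a" assume C: "Cauchy X" "Cauchy Y"
    have "(\<lambda>n. cinner (X n) (Y n)) \<longlonglongrightarrow> cnj (completion_cinner (abs_completion Y) (abs_completion X))"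
      using tendsto_cnj[OF LIMSEQ_completion_cinner[OF C(2,1)]] by (simp add: cinner_commute[symmetric])
    from LIMSEQ_unique[OF LIMSEQ_completion_cinner[OF C] this]
    show "completion_cinner (abs_completion X) (abs_completion Y) =
      cnj (completion_cinner (abs_completion Y) (abs_completion X))" .
  qed
  show "completion_cinner (s + t) u = completion_cinner s u + completion_cinner t u"
  proof (induction s rule: completion_induct; induction t rule: completion_induct;
      induction u rule: completion_induct)
    fix X Y Z :: "nat \<Rightarrow> 'a" assume C: "Cauchy X" "Cauchy Y" "Cauchy Z"
    have "(\<lambda>n. cinner (X n + Y n) (Z n)) \<longlonglongrightarrow>
        completion_cinner (abs_completion X) (abs_completion Z) +
        completion_cinner (abs_completion Y) (abs_completion Z)"
      unfolding cinner_add_left by (intro tendsto_add LIMSEQ_completion_cinner C)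
    from LIMSEQ_unique[OF LIMSEQ_completion_cinner[OF Cauchy_add[OF C(1,2)] C(3)] this]
    show "completion_cinner (abs_completion X + abs_completion Y) (abs_completion Z) =
        completion_cinner (abs_completion X) (abs_completion Z) +
        completion_cinner (abs_completion Y) (abs_completion Z)"
      by (simp add: abs_completion_add C)
  qed
  show "completion_cinner (c *\<^sub>C s) t = c * completion_cinner s t"
  proof (induction s rule: completion_induct; induction t rule: completion_induct)
    fix X Y :: "nat \<Rightarrow> 'a" assume C: "Cauchy X" "Cauchy Y"
    have "(\<lambda>n. cinner (c *\<^sub>C X n) (Y n)) \<longlonglongrightarrow> c * completion_cinner (abs_completion X) (abs_completion Y)"
      unfolding cinner_scaleC_left by (intro tendsto_mult_left LIMSEQ_completion_cinner C)
    from LIMSEQ_unique[OF LIMSEQ_completion_cinner[OF Cauchy_scaleC[OF C(1)] C(2)] this]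
    show "completion_cinner (c *\<^sub>C abs_completion X) (abs_completion Y) =
        c * completion_cinner (abs_completion X) (abs_completion Y)"
      by (simp add: abs_completion_scaleC C)
  qed
  show "0 \<le> Re (completion_cinner s s)"
  proof (induction s rule: completion_induct)
    case (Cauchy X)
    show ?case
      by (rule LIMSEQ_le_const[OF tendsto_Re[OF LIMSEQ_completion_cinner[OF Cauchy Cauchy]]])
        (simp add: cinner_ge_zero)
  qed
  show "completion_cinner s s = 0 \<Longrightarrow> s = 0"
  proof (induction s rule: completion_induct)
    case (Cauchy X)
    have "(\<lambda>n. (norm (X n))\<^sup>2) \<longlonglongrightarrow> 0"
      using tendsto_Re[OF LIMSEQ_completion_cinner[OF Cauchy(1,1)]] Cauchy(2)
      by (simp add: norm_power2_cinner)
    from tendsto_real_sqrt[OF this] have "X \<longlonglongrightarrow> 0"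
      by (simp add: tendsto_norm_zero_iff)
    then have "completion_rel X (\<lambda>_. 0)"
      using Cauchy(1) by (simp add: completion_rel_def Cauchy_const)
    then show ?case
      by (simp add: zero_completion_def Quotient3_rel_abs[OF Quotient3_completion])
  qed
qed

instantiation completion :: (complex_inner) complex_inner
begin

definition cinner_completion :: "'a completion \<Rightarrow> 'a completion \<Rightarrow> complex" where
  "cinner_completion = completion_cinner"
definition norm_completion :: "'a completion \<Rightarrow> real" where
  "norm_completion u = sqrt (Re (cinner u u))"
definition sgn_completion :: "'a completion \<Rightarrow> 'a completion" where
  "sgn_completion u = u /\<^sub>R norm u"
definition dist_completion :: "'a completion \<Rightarrow> 'a completion \<Rightarrow> real" where
  "dist_completion u v = norm (u - v)"
definition uniformity_completion :: "('a completion \<times> 'a completion) filter" where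
  "uniformity_completion = (INF e\<in>{0<..}. principal {(x, y). dist x y < e})"
definition open_completion :: "'a completion set \<Rightarrow> bool" where
  "open_completion U \<longleftrightarrow> (\<forall>x\<in>U. \<forall>\<^sub>F (x', y) in uniformity. x' = x \<longrightarrow> y \<in> U)"

instance
proof
  fix s t u :: "'a completion" and c :: complex and r :: real and U :: "'a completion set"
  show "dist s t = norm (s - t)" by (rule dist_completion_def)
  show "sgn s = s /\<^sub>R norm s" by (rule sgn_completion_def)
  show "(uniformity :: ('a completion \<times> _) filter) = (INF e\<in>{0<..}. principal {(x, y). dist x y < e})"
    by (rule uniformity_completion_def)
  show "open U = (\<forall>x\<in>U. \<forall>\<^sub>F (x', y) in uniformity. x' = x \<longrightarrow> y \<in> U)" by (rule open_completion_def)
  show "(norm s = 0) = (s = 0)"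
    unfolding norm_completion_def cinner_completion_def by (rule completion.sqrt_eq_zero_iff)
  show "norm (s + t) \<le> norm s + norm t"
    unfolding norm_completion_def cinner_completion_def by (rule completion.triangle)
  show "norm (r *\<^sub>R s) = \<bar>r\<bar> * norm s"
    unfolding norm_completion_def cinner_completion_def by (rule completion.sqrt_scaleR)
  show "cinner s t = cnj (cinner t s)" unfolding cinner_completion_def by (rule completion.sym)
  show "cinner (s + t) u = cinner s u + cinner t u" unfolding cinner_completion_def by (rule completion.add_left)
  show "cinner (c *\<^sub>C s) t = c * cinner s t" unfolding cinner_completion_def by (rule completion.scale_left)
  show "0 \<le> Re (cinner s s)" unfolding cinner_completion_def by (rule completion.ge_zero)
  show "(cinner s s = 0) = (s = 0)" unfolding cinner_completion_def by (rule completion.eq_zero_iff)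
  show "norm s = sqrt (Re (cinner s s))" by (rule norm_completion_def)
qed

end

lemma LIMSEQ_cinner_completion:
  "Cauchy X \<Longrightarrow> Cauchy Y \<Longrightarrow>
    (\<lambda>n. cinner (X n) (Y n)) \<longlonglongrightarrow> cinner (abs_completion X) (abs_completion Y)"
  unfolding cinner_completion_def by (rule LIMSEQ_completion_cinner)

lemma LIMSEQ_norm_completion:
  "Cauchy X \<Longrightarrow> (\<lambda>n. norm (X n)) \<longlonglongrightarrow> norm (abs_completion X)"
  unfolding norm_eq_sqrt_cinner by (intro tendsto_real_sqrt tendsto_Re LIMSEQ_cinner_completion)

lift_definition completion_of :: "'a::complex_inner \<Rightarrow> 'a completion" is "\<lambda>x _. x"
  by (simp add: Cauchy_const)

lemma completion_of_add: "completion_of (x + y) = completion_of x + completion_of y"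
  by (simp add: completion_of_def abs_completion_add Cauchy_const)

lemma completion_of_scaleC: "completion_of (c *\<^sub>C x) = c *\<^sub>C completion_of x"
  by (simp add: completion_of_def abs_completion_scaleC Cauchy_const)

lemma completion_of_diff: "completion_of (x - y) = completion_of x - completion_of y"
  by (simp add: completion_of_def abs_completion_diff Cauchy_const)

lemma cinner_completion_of [simp]: "cinner (completion_of x) (completion_of y) = cinner x y"
  using LIMSEQ_unique[OF tendsto_const LIMSEQ_cinner_completion[OF Cauchy_const[of x] Cauchy_const[of y]]]
  by (simp add: completion_of_def)

lemma norm_completion_of [simp]: "norm (completion_of x) = norm x"
  by (simp add: norm_eq_sqrt_cinner)

lemma completion_of_tendsto:
  assumes "Cauchy X"
  shows "(\<lambda>n. completion_of (X n)) \<longlonglongrightarrow> abs_completion X"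
proof (rule LIMSEQ_I)
  fix e :: real
  assume e: "0 < e"
  then obtain M where M: "\<And>m n. m \<ge> M \<Longrightarrow> n \<ge> M \<Longrightarrow> norm (X m - X n) < e / 2"
    using CauchyD[OF assms, of "e / 2"] by auto
  have "norm (completion_of (X n) - abs_completion X) < e" if n: "n \<ge> M" for n
  proof -
    have "(\<lambda>m. norm (X n - X m)) \<longlonglongrightarrow> norm (completion_of (X n) - abs_completion X)"
      using LIMSEQ_norm_completion[OF Cauchy_diff[OF Cauchy_const[of "X n"] assms]]
      by (simp add: completion_of_def abs_completion_diff Cauchy_const assms)
    then have "norm (completion_of (X n) - abs_completion X) \<le> e / 2"
      by (rule LIMSEQ_le_const2) (use M n in \<open>auto intro!: exI[of _ M] less_imp_le\<close>)
    then show ?thesis using e by simp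
  qed
  then show "\<exists>N. \<forall>n\<ge>N. norm (completion_of (X n) - abs_completion X) < e" by blast
qed

lemma completion_of_dense: "closure (range completion_of) = UNIV"
proof -
  have "u \<in> closure (range completion_of)" for u :: "'a completion"
  proof (induction u rule: completion_induct)
    case (Cauchy X)
    show ?case
      unfolding closure_sequential
      by (rule exI[of _ "\<lambda>n. completion_of (X n)"]) (simp add: completion_of_tendsto Cauchy)
  qed
  then show ?thesis by auto
qed

instance completion :: (complex_inner) chilbert_space
proof
  fix S :: "nat \<Rightarrow> 'a completion"
  assume S: "Cauchy S"
  have "\<exists>x. norm (S n - completion_of x) < inverse (real (Suc n))" for n
  proof -
    have "S n \<in> closure (range completion_of)" by (simp add: completion_of_dense)
    then obtain v where "v \<in> range completion_of" "dist v (S n) < inverse (real (Suc n))"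
      unfolding closure_approachable by (meson inverse_positive_iff_positive of_nat_0_less_iff zero_less_Suc)
    then show ?thesis by (auto simp: dist_norm norm_minus_commute)
  qed
  then obtain x where x: "\<And>n. norm (S n - completion_of (x n)) < inverse (real (Suc n))" by metis
  have null: "(\<lambda>n. S n - completion_of (x n)) \<longlonglongrightarrow> 0"
    by (rule Lim_null_comparison[OF _ LIMSEQ_inverse_real_of_nat])
      (use x in \<open>auto intro!: always_eventually less_imp_le\<close>)
  have "Cauchy (\<lambda>n. S n - (S n - completion_of (x n)))"
    by (intro Cauchy_diff S LIMSEQ_imp_Cauchy[OF null])
  then have "Cauchy (\<lambda>n. completion_of (x n))" by simp
  then have "Cauchy x"
    by (simp add: Cauchy_iff completion_of_diff[symmetric])
  from tendsto_add[OF null completion_of_tendsto[OF this]] show "convergent S"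
    by (auto simp: convergent_def)
qed

section \<open>The Hilbert space tensor product\<close>

type_synonym ('a, 'b) htensor = "('a, 'b) atensor completion"

definition tensor :: "'a::complex_inner \<Rightarrow> 'b::complex_inner \<Rightarrow> ('a, 'b) htensor"  (infixr "\<otimes>" 70) where
  "x \<otimes> y = completion_of (atens x y)"

lemma cinner_tensor: "cinner (x \<otimes> y) (z \<otimes> u) = cinner x z * cinner y u"
  by (simp add: tensor_def cinner_atens)

lemma norm_tensor: "norm (x \<otimes> y) = norm x * norm y"
proof -
  have 1: "Re (cinner (x \<otimes> y) (x \<otimes> y)) = Re (cinner x x * cinner y y)"
    unfolding cinner_tensor ..
  have 2: "cinner x x * cinner y y = complex_of_real ((norm x)\<^sup>2 * (norm y)\<^sup>2)"
    unfolding cinner_self of_real_mult ..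
  have "(norm (x \<otimes> y))\<^sup>2 = (norm x * norm y)\<^sup>2"
    by (simp only: norm_power2_cinner[of "x \<otimes> y"] 1 2 Re_complex_of_real power_mult_distrib)
  then show ?thesis by (rule power2_eq_imp_eq) simp_all
qed

lemma cbilinear_tensor: "cbilinear (\<otimes>)"
  by (simp add: cbilinear_def tensor_def atens_add_left atens_add_right atens_scaleC_left
      atens_scaleC_right completion_of_add completion_of_scaleC)

section \<open>Operators\<close>

definition bounded_clinear :: "('a::complex_inner \<Rightarrow> 'b::complex_inner) \<Rightarrow> bool" where
  "bounded_clinear T \<longleftrightarrow> bounded_linear T \<and> (\<forall>c x. T (c *\<^sub>C x) = c *\<^sub>C T x)"

text \<open>The supremum is taken in \<open>[0, \<infinity>)\<close>, so that the zero space, which has no unit vectors, gets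
  numerical radius 0.\<close>

definition numerical_radius :: "('a::complex_inner \<Rightarrow> 'a) \<Rightarrow> real" where
  "numerical_radius T = Sup (insert 0 {cmod (cinner (T x) x) | x. norm x = 1})"

definition cadjoint :: "('a::chilbert_space \<Rightarrow> 'b::chilbert_space) \<Rightarrow> 'b \<Rightarrow> 'a" where
  "cadjoint T = (THE S. bounded_clinear S \<and> (\<forall>x y. cinner (T x) y = cinner x (S y)))"

definition tensor_op :: "('a::chilbert_space \<Rightarrow> 'c::chilbert_space) \<Rightarrow> ('b::chilbert_space \<Rightarrow> 'd::chilbert_space) \<Rightarrow>
    ('a, 'b) htensor \<Rightarrow> ('c, 'd) htensor"  (infixr "\<otimes>\<^sub>o" 70) where
  "A \<otimes>\<^sub>o B = (THE T. bounded_clinear T \<and> (\<forall>x y. T (x \<otimes> y) = A x \<otimes> B y))"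

subsection \<open>Existence and uniqueness of adjoints\<close>

lemma bounded_clinear_props:
  assumes "bounded_clinear T"
  shows "bounded_linear T" "T (x + y) = T x + T y" "T (c *\<^sub>C x) = c *\<^sub>C T x" "T 0 = 0"
  using assms linear_simps[of T] by (auto simp: bounded_clinear_def)

lemma bounded_clinearI:
  assumes "\<And>x y. T (x + y) = T x + T y" "\<And>c x. T (c *\<^sub>C x) = c *\<^sub>C T x"
    "\<And>x. norm (T x) \<le> norm x * K"
  shows "bounded_clinear T"
  unfolding bounded_clinear_def
  by (intro conjI bounded_linear_intro[of _ K]) (simp_all add: assms scaleR_scaleC)

lemma riesz_real:
  fixes f :: "'a::chilbert_space \<Rightarrow> real"
  assumes "bounded_linear f"
  shows "\<exists>u. \<forall>h. f h = Re (cinner u h)"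
proof -
  interpret f: bounded_linear f by fact
  obtain K where K: "\<And>x. norm (f x) \<le> norm x * K" using f.bounded by blast
  define \<phi> where "\<phi> x = (norm x)\<^sup>2 - 2 * f x" for x
  have low: "- K\<^sup>2 \<le> \<phi> x" for x
  proof -
    have "f x \<le> norm x * K" using K[of x] by simp
    moreover have "0 \<le> (norm x - K)\<^sup>2" by simp
    ultimately show ?thesis unfolding \<phi>_def power2_diff by linarith
  qed
  have bdd: "bdd_below (range \<phi>)" by (rule bdd_belowI2[of _ "- K\<^sup>2"]) (rule low)
  define d where "d = Inf (range \<phi>)"
  have d: "d \<le> \<phi> x" for x unfolding d_def by (rule cInf_lower) (use bdd in auto)
  have "\<exists>x. \<phi> x < d + inverse (real (Suc n))" for n
    using cInf_lessD[of "range \<phi>" "d + inverse (real (Suc n))"] by (auto simp: d_def)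
  then obtain x where x: "\<And>n. \<phi> (x n) < d + inverse (real (Suc n))" by metis
  have expand: "(norm (a + b))\<^sup>2 = (norm a)\<^sup>2 + (norm b)\<^sup>2 + 2 * Re (cinner a b)" for a b :: 'a
    using cinner_commute[of b a] by (simp add: norm_power2_cinner cinner_add_left cinner_add_right)
  have par: "(norm (a - b))\<^sup>2 = 2 * (\<phi> a + \<phi> b - 2 * \<phi> ((1/2) *\<^sub>R (a + b)))" for a b
  proof -
    have 1: "(norm (a - b))\<^sup>2 = (norm a)\<^sup>2 + (norm b)\<^sup>2 - 2 * Re (cinner a b)"
      using expand[of a "- b"] by (simp add: cinner_bilinear.minus_right)
    have 2: "\<phi> ((1/2) *\<^sub>R (a + b)) = (norm (a + b))\<^sup>2 / 4 - f (a + b)"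
      by (simp only: \<phi>_def norm_scaleR f.scaleR) (simp add: power_divide)
    show ?thesis unfolding 1 2 by (simp add: \<phi>_def f.add expand[of a b] field_simps)
  qed
  have "Cauchy x"
  proof (rule CauchyI)
    fix e :: real assume e: "0 < e"
    then obtain N where N: "inverse (real (Suc N)) < e\<^sup>2 / 4"
      using reals_Archimedean[of "e\<^sup>2 / 4"] by auto
    have "norm (x m - x n) < e" if "m \<ge> N" "n \<ge> N" for m n
    proof -
      have "\<phi> (x k) < d + e\<^sup>2 / 4" if "k \<ge> N" for k
      proof -
        have "inverse (real (Suc k)) \<le> inverse (real (Suc N))"
          using that by (intro le_imp_inverse_le) auto
        then show ?thesis using x[of k] N by linarith
      qed
      note close = this[OF that(1)] this[OF that(2)]
      have "2 * (a + b - 2 * p) < q" if "a < d + q / 4" "b < d + q / 4" "d \<le> p" for a b p q :: real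
      proof -
        have "a + b < 2 * p + q / 2" using that by simp
        then show ?thesis by (simp add: algebra_simps)
      qed
      from this[OF close d] have "(norm (x m - x n))\<^sup>2 < e\<^sup>2" unfolding par .
      then show ?thesis using e power2_less_imp_less by fastforce
    qed
    then show "\<exists>M. \<forall>m\<ge>M. \<forall>n\<ge>M. norm (x m - x n) < e" by blast
  qed
  then obtain u where u: "x \<longlonglongrightarrow> u" by (auto simp: Cauchy_convergent_iff convergent_def)
  have "(\<lambda>n. \<phi> (x n)) \<longlonglongrightarrow> \<phi> u"
    unfolding \<phi>_def by (intro tendsto_intros f.tendsto u)
  moreover have "(\<lambda>n. d + inverse (real (Suc n))) \<longlonglongrightarrow> d + 0"
    by (intro tendsto_intros LIMSEQ_inverse_real_of_nat)
  ultimately have "\<phi> u \<le> d"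
    using LIMSEQ_le[of "\<lambda>n. \<phi> (x n)" "\<phi> u" "\<lambda>n. d + inverse (real (Suc n))" d] x
    by (auto intro: less_imp_le)
  then have min: "\<phi> u \<le> \<phi> z" for z using d[of z] by linarith
  have "f h = Re (cinner u h)" for h
  proof (cases "h = 0")
    case False
    define b where "b = Re (cinner u h) - f h"
    define t where "t = - b / (norm h)\<^sup>2"
    have "\<phi> (u + t *\<^sub>R h) = \<phi> u + 2 * t * b + t\<^sup>2 * (norm h)\<^sup>2"
      by (simp add: \<phi>_def expand f.add f.scaleR cinner_bilinear.scaleR_right b_def power_mult_distrib algebra_simps)
    also have "\<dots> = \<phi> u - b\<^sup>2 / (norm h)\<^sup>2"
      using False by (simp add: t_def field_simps power2_eq_square)
    finally have "b\<^sup>2 / (norm h)\<^sup>2 \<le> 0" using min[of "u + t *\<^sub>R h"] by simp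
    then have "b = 0" using False by (simp add: divide_le_0_iff)
    then show ?thesis by (simp add: b_def)
  qed (simp add: f.zero)
  then show ?thesis by blast
qed

lemma cinner_ext: "(\<And>x. cinner x u = cinner x v) \<Longrightarrow> u = v"
proof -
  assume "\<And>x. cinner x u = cinner x v"
  then have "cinner (u - v) (u - v) = 0" by (simp add: cinner_bilinear.diff_right)
  then show "u = v" by (simp add: cinner_eq_zero_iff)
qed

theorem cadjoint_ex1:
  fixes T :: "'a::chilbert_space \<Rightarrow> 'b::chilbert_space"
  assumes "bounded_clinear T"
  shows "\<exists>!S. bounded_clinear S \<and> (\<forall>x y. cinner (T x) y = cinner x (S y))"
proof -
  note T = bounded_clinear_props[OF assms]
  have "\<exists>u. \<forall>x. cinner (T x) y = cinner x u" for y
  proof -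
    have "bounded_linear (\<lambda>x. Re (cinner (T x) y))"
      by (rule bounded_linear_compose[OF bounded_linear_Re
            bounded_linear_compose[OF cinner_bilinear.bounded_linear_left T(1)]])
    then obtain u where u: "\<And>x. Re (cinner (T x) y) = Re (cinner u x)" using riesz_real by blast
    have "cinner (T x) y = cinner x u" for x
    proof (rule complex_eqI)
      show "Re (cinner (T x) y) = Re (cinner x u)" using u[of x] by (subst cinner_commute) simp
      show "Im (cinner (T x) y) = Im (cinner x u)"
        using u[of "\<i> *\<^sub>C x"] cinner_commute[of x u]
        by (simp add: T cinner_scaleC_left cinner_scaleC_right)
    qed
    then show ?thesis by blast
  qed
  then obtain S where S: "\<And>x y. cinner (T x) y = cinner x (S y)" by metis
  obtain K where K0: "0 \<le> K" and K: "\<And>x. norm (T x) \<le> norm x * K"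
    using bounded_linear.nonneg_bounded[OF T(1)] by blast
  have "bounded_clinear S"
  proof (rule bounded_clinearI)
    show "S (y + z) = S y + S z" for y z
      by (rule cinner_ext) (simp add: S[symmetric] cinner_add_right)
    show "S (c *\<^sub>C y) = c *\<^sub>C S y" for c y
      by (rule cinner_ext) (simp add: S[symmetric] cinner_scaleC_right)
    show "norm (S y) \<le> norm y * K" for y
    proof (cases "S y = 0")
      case True
      then show ?thesis using K0 by simp
    next
      case False
      have "(norm (S y))\<^sup>2 = Re (cinner (T (S y)) y)" by (simp add: S norm_power2_cinner)
      also have "\<dots> \<le> norm (T (S y)) * norm y"
        using complex_Re_le_cmod cinner_cauchy_schwarz order.trans by blast
      also have "\<dots> \<le> norm (S y) * K * norm y" by (intro mult_right_mono K) simp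
      finally show ?thesis using False by (simp add: power2_eq_square mult.assoc mult.commute)
    qed
  qed
  moreover have "S' = S" if "\<forall>x y. cinner (T x) y = cinner x (S' y)" for S'
    by (rule ext, rule cinner_ext) (metis S that)
  ultimately show ?thesis using S by blast
qed

lemma
  assumes "bounded_clinear T"
  shows bounded_clinear_cadjoint: "bounded_clinear (cadjoint T)"
    and cadjoint: "cinner (T x) y = cinner x (cadjoint T y)"
  using theI'[OF cadjoint_ex1[OF assms]] unfolding cadjoint_def[symmetric] by blast+

subsection \<open>Existence and uniqueness of tensor products of operators\<close>

lemma completion_extend:
  fixes g :: "'a::complex_inner \<Rightarrow> 'b::chilbert_space"
  assumes g: "bounded_clinear g"
  obtains G where "bounded_clinear G" "\<And>x. G (completion_of x) = g x"
proof -
  note gp = bounded_clinear_props[OF g]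
  interpret g: bounded_linear g by (rule gp(1))
  define G where "G u = lim (\<lambda>n. g (rep_completion u n))" for u
  have G: "(\<lambda>n. g (X n)) \<longlonglongrightarrow> G (abs_completion X)" if X: "Cauchy X" for X
  proof -
    let ?Y = "rep_completion (abs_completion X)"
    have "completion_rel ?Y X"
      using X by (intro rep_abs_rsp_left[OF Quotient3_completion]) simp
    then have Y: "Cauchy ?Y" "(\<lambda>n. ?Y n - X n) \<longlonglongrightarrow> 0" by (auto simp: completion_rel_def)
    have "(\<lambda>n. g (?Y n)) \<longlonglongrightarrow> G (abs_completion X)"
      unfolding G_def convergent_LIMSEQ_iff[symmetric]
      by (rule Cauchy_convergent) (rule g.Cauchy[OF Y(1)])
    from tendsto_diff[OF this g.tendsto[OF Y(2)]] show ?thesis by (simp add: g.diff g.zero)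
  qed
  obtain K where K: "\<And>x. norm (g x) \<le> norm x * K" using g.bounded by blast
  have "bounded_clinear G"
  proof (rule bounded_clinearI)
    show "G (u + v) = G u + G v" for u v
    proof (induction u rule: completion_induct; induction v rule: completion_induct)
      fix X Y :: "nat \<Rightarrow> 'a" assume C: "Cauchy X" "Cauchy Y"
      have "(\<lambda>n. g (X n + Y n)) \<longlonglongrightarrow> G (abs_completion X) + G (abs_completion Y)"
        unfolding gp(2) by (intro tendsto_add G C)
      from LIMSEQ_unique[OF G[OF Cauchy_add[OF C]] this]
      show "G (abs_completion X + abs_completion Y) = G (abs_completion X) + G (abs_completion Y)"
        by (simp add: abs_completion_add C)
    qed
    show "G (c *\<^sub>C u) = c *\<^sub>C G u" for c u
    proof (induction u rule: completion_induct)
      case C: (Cauchy X)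
      have "(\<lambda>n. g (c *\<^sub>C X n)) \<longlonglongrightarrow> c *\<^sub>C G (abs_completion X)"
        unfolding gp(3) by (intro bounded_linear.tendsto[OF bounded_linear_scaleC] G C)
      from LIMSEQ_unique[OF G[OF Cauchy_scaleC[OF C]] this]
      show ?case by (simp add: abs_completion_scaleC C)
    qed
    show "norm (G u) \<le> norm u * K" for u
    proof (induction u rule: completion_induct)
      case C: (Cauchy X)
      show ?case
        by (rule LIMSEQ_le[OF tendsto_norm[OF G[OF C]] tendsto_mult_right[OF LIMSEQ_norm_completion[OF C]]])
          (use K in auto)
    qed
  qed
  moreover have "G (completion_of x) = g x" for x
    using LIMSEQ_unique[OF G[OF Cauchy_const[of x]] tendsto_const] by (simp add: completion_of_def)
  ultimately show ?thesis by (rule that)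
qed

definition atensor_map ::
  "('a::complex_inner \<Rightarrow> 'c::complex_inner) \<Rightarrow> ('b::complex_inner \<Rightarrow> 'd::complex_inner) \<Rightarrow>
    ('a, 'b) atensor \<Rightarrow> ('c, 'd) atensor" where
  "atensor_map A B = atensor_extend (\<lambda>x y. atens (A x) (B y))"

definition atensor_swap :: "('a::complex_inner, 'b::complex_inner) atensor \<Rightarrow> ('b, 'a) atensor" where
  "atensor_swap = atensor_extend (\<lambda>x y. atens y x)"

lemma cbilinear_map:
  assumes "bounded_clinear A" "bounded_clinear B"
  shows "cbilinear (\<lambda>x y. atens (A x) (B y))"
  by (simp add: cbilinear_def bounded_clinear_props[OF assms(1)] bounded_clinear_props[OF assms(2)]
      atens_add_left atens_add_right atens_scaleC_left atens_scaleC_right)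

lemma cbilinear_swap: "cbilinear (\<lambda>x y. atens y x)"
  by (simp add: cbilinear_def atens_add_left atens_add_right atens_scaleC_left atens_scaleC_right)

lemma atensor_extend_zero: "cbilinear h \<Longrightarrow> atensor_extend h 0 = 0"
  using atensor_extend_scaleC[of h 0 0] by simp

lemma atensor_extend_sum:
  "cbilinear h \<Longrightarrow> atensor_extend h (\<Sum>i\<in>I. t i) = (\<Sum>i\<in>I. atensor_extend h (t i))"
  by (induction I rule: infinite_finite_induct) (auto simp: atensor_extend_zero atensor_extend_add)

lemma norm_atensor_swap: "norm (atensor_swap t) = norm t"
proof -
  obtain E y where "t = (\<Sum>e\<in>E. atens e (y e))" by (rule atensor_orthonormal)
  then have "cinner (atensor_swap t) (atensor_swap t) = cinner t t"
    by (simp add: atensor_swap_def atensor_extend_sum[OF cbilinear_swap] atensor_extend_atens[OF cbilinear_swap]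
        cinner_bilinear.sum_left cinner_bilinear.sum_right cinner_atens mult.commute)
  then show ?thesis by (simp add: norm_eq_sqrt_cinner)
qed

lemma bounded_clinear_id: "bounded_clinear (\<lambda>x. x)"
  by (rule bounded_clinearI[of _ 1]) auto

lemma norm_atensor_map_right:
  fixes t :: "('a::complex_inner, 'b::complex_inner) atensor" and B :: "'b \<Rightarrow> 'd::complex_inner"
  assumes "bounded_clinear B"
  shows "norm (atensor_map (\<lambda>x. x) B t) \<le> onorm B * norm t"
proof -
  note bl = cbilinear_map[OF bounded_clinear_id assms]
  note B = bounded_clinear_props[OF assms]
  obtain E y where E: "finite E" "orthonormal E" and t: "t = (\<Sum>e\<in>E. atens e (y e))"
    by (rule atensor_orthonormal)
  have n: "(norm (\<Sum>e\<in>E. atens e (z e)))\<^sup>2 = (\<Sum>e\<in>E. (norm (z e))\<^sup>2)"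
    for z :: "'a \<Rightarrow> 'z::complex_inner"
    by (simp add: norm_power2_cinner cinner_atensor_def atensor_cinner_orthonormal[OF E])
  have "(norm (atensor_map (\<lambda>x. x) B t))\<^sup>2 = (\<Sum>e\<in>E. (norm (B (y e)))\<^sup>2)"
    by (simp add: t atensor_map_def atensor_extend_sum[OF bl] atensor_extend_atens[OF bl] n)
  also have "\<dots> \<le> (\<Sum>e\<in>E. (onorm B * norm (y e))\<^sup>2)"
    by (intro sum_mono power_mono onorm[OF B(1)]) simp
  also have "\<dots> = (onorm B * norm t)\<^sup>2"
    by (simp add: t power_mult_distrib n sum_distrib_left)
  finally show ?thesis
    by (rule power2_le_imp_le) (simp add: onorm_pos_le[OF B(1)])
qed

lemma atensor_map_simps:
  assumes "bounded_clinear A" "bounded_clinear B"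
  shows "atensor_map A B 0 = 0" "atensor_map A B (s + t) = atensor_map A B s + atensor_map A B t"
    "atensor_map A B (c *\<^sub>C s) = c *\<^sub>C atensor_map A B s" "atensor_map A B (atens x y) = atens (A x) (B y)"
  unfolding atensor_map_def
  by (simp_all add: atensor_extend_zero atensor_extend_add atensor_extend_scaleC atensor_extend_atens
      cbilinear_map assms)

lemma atensor_swap_simps:
  "atensor_swap 0 = 0" "atensor_swap (s + t) = atensor_swap s + atensor_swap t"
  "atensor_swap (atens x y) = atens y x"
  unfolding atensor_swap_def
  by (simp_all add: atensor_extend_zero atensor_extend_add atensor_extend_atens cbilinear_swap)

lemma atensor_map_factor:
  assumes "bounded_clinear A" "bounded_clinear B"
  shows "atensor_map A B t =
    atensor_swap (atensor_map (\<lambda>x. x) A (atensor_swap (atensor_map (\<lambda>x. x) B t)))"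
  by (induction t rule: atensor_induct)
    (simp_all add: atensor_map_simps atensor_swap_simps assms bounded_clinear_id)

lemma norm_atensor_map:
  assumes "bounded_clinear A" "bounded_clinear B"
  shows "norm (atensor_map A B t) \<le> onorm A * onorm B * norm t"
proof -
  have "norm (atensor_map A B t) \<le> onorm A * norm (atensor_map (\<lambda>x. x) B t)"
    unfolding atensor_map_factor[OF assms] norm_atensor_swap
    using norm_atensor_map_right[OF assms(1), of "atensor_swap (atensor_map (\<lambda>x. x) B t)"]
    by (simp add: norm_atensor_swap)
  also have "\<dots> \<le> onorm A * (onorm B * norm t)"
    by (intro mult_left_mono norm_atensor_map_right assms onorm_pos_le bounded_clinear_props(1))
  finally show ?thesis by (simp add: mult.assoc)
qed

lemma completion_of_zero [simp]: "completion_of 0 = 0"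
  using completion_of_scaleC[of 0 0] by simp

lemma htensor_ext:
  assumes "bounded_clinear S" "bounded_clinear T" "\<And>x y. S (x \<otimes> y) = T (x \<otimes> y)"
  shows "S = T"
proof
  note S = bounded_clinear_props[OF assms(1)] and T = bounded_clinear_props[OF assms(2)]
  have eq: "S (completion_of t) = T (completion_of t)" for t
  proof (induction t rule: atensor_induct)
    case zero
    show ?case by (simp add: S(4) T(4))
  next
    case (add x y t)
    then show ?case using assms(3)[of x y] by (simp add: completion_of_add S(2) T(2) tensor_def)
  qed
  fix u show "S u = T u"
  proof (induction u rule: completion_induct)
    case (Cauchy X)
    have "(\<lambda>n. S (completion_of (X n))) \<longlonglongrightarrow> S (abs_completion X)"
      "(\<lambda>n. T (completion_of (X n))) \<longlonglongrightarrow> T (abs_completion X)"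
      by (intro bounded_linear.tendsto[OF S(1)] bounded_linear.tendsto[OF T(1)] completion_of_tendsto Cauchy)+
    then show ?case by (simp add: eq LIMSEQ_unique)
  qed
qed

theorem tensor_op_ex1:
  assumes "bounded_clinear A" "bounded_clinear B"
  shows "\<exists>!T. bounded_clinear T \<and> (\<forall>x y. T (x \<otimes> y) = A x \<otimes> B y)"
proof (rule ex_ex1I)
  have "bounded_clinear (\<lambda>t. completion_of (atensor_map A B t))"
    by (rule bounded_clinearI[of _ "onorm A * onorm B"])
      (use norm_atensor_map[OF assms] in \<open>simp_all add: atensor_map_simps assms completion_of_add
        completion_of_scaleC mult.commute\<close>)
  then obtain T where "bounded_clinear T" "\<And>t. T (completion_of t) = completion_of (atensor_map A B t)"
    by (rule completion_extend) blast
  then show "\<exists>T. bounded_clinear T \<and> (\<forall>x y. T (x \<otimes> y) = A x \<otimes> B y)"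
    by (auto simp: tensor_def atensor_map_simps assms)
qed (auto intro: htensor_ext)

lemma
  assumes "bounded_clinear A" "bounded_clinear B"
  shows bounded_clinear_tensor_op: "bounded_clinear (A \<otimes>\<^sub>o B)"
    and tensor_op_tensor: "(A \<otimes>\<^sub>o B) (x \<otimes> y) = A x \<otimes> B y"
  using theI'[OF tensor_op_ex1[OF assms]] unfolding tensor_op_def[symmetric] by blast+

end

theory Submission
  imports Defs
begin

text \<open>
  Write \<open>T = A \<otimes>\<^sub>o B\<close>. The adjoint of \<open>T\<close> is \<open>T\<^sup>* = A\<^sup>* \<otimes>\<^sub>o B\<^sup>*\<close>
  (\<open>cadjoint_tensor_op\<close>), so the two norms in the bound are \<open>p = \<parallel>T + T\<^sup>*\<parallel>\<close> and
  \<open>q = \<parallel>T - T\<^sup>*\<parallel>\<close>: twice the norms of the real and the imaginary part of \<open>T\<close>.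

  Both are at most \<open>2 w(T)\<close> (\<open>onorm_add_scaleC_cadjoint_le\<close>), because polarization controls the
  bilinear expression \<open>\<langle>Tx, y\<rangle> + \<langle>Ty, x\<rangle>\<close> by the quadratic form of \<open>T\<close>. Hence
  \<open>w(T) \<ge> max p q / 2 = (p + q) / 4 + \<bar>p - q\<bar> / 4\<close>. Finally \<open>2 T = (T + T\<^sup>*) + (T - T\<^sup>*)\<close> gives
  \<open>p + q \<ge> 2 \<parallel>T\<parallel>\<close>, and testing \<open>T\<close> on elementary tensors gives \<open>\<parallel>T\<parallel> \<ge> \<parallel>A\<parallel> \<parallel>B\<parallel>\<close>
  (\<open>onorm_mult_le_onorm_tensor_op\<close>).
\<close>

lemma numerical_radius_bdd_above:
  assumes "bounded_clinear T"
  shows "bdd_above (insert 0 {cmod (cinner (T x) x) | x. norm x = 1})"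
proof (rule bdd_aboveI[of _ "onorm T"])
  note T = bounded_clinear_props(1)[OF assms]
  fix r assume "r \<in> insert 0 {cmod (cinner (T x) x) | x. norm x = 1}"
  then consider "r = 0" | x where "r = cmod (cinner (T x) x)" "norm x = 1" by auto
  then show "r \<le> onorm T"
  proof cases
    case 1
    then show ?thesis by (simp add: onorm_pos_le[OF T])
  next
    case 2
    then show ?thesis
      using cinner_cauchy_schwarz[of "T x" x] onorm[OF T, of x] by simp
  qed
qed

lemma numerical_radius_nonneg:
  "bounded_clinear T \<Longrightarrow> 0 \<le> numerical_radius T"
  unfolding numerical_radius_def by (rule cSup_upper[OF insertI1 numerical_radius_bdd_above])

lemma cmod_cinner_le_numerical_radius:
  assumes "bounded_clinear T"
  shows "cmod (cinner (T x) x) \<le> numerical_radius T * (norm x)\<^sup>2"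
proof (cases "x = 0")
  case False
  define e where "e = complex_of_real (inverse (norm x)) *\<^sub>C x"
  have x: "x = complex_of_real (norm x) *\<^sub>C e"
    using False by (simp add: e_def scaleC_scaleC scaleC_one)
  have "norm e = 1" using False by (simp add: e_def norm_scaleC norm_inverse)
  then have "cmod (cinner (T e) e) \<le> numerical_radius T"
    unfolding numerical_radius_def
    by (intro cSup_upper numerical_radius_bdd_above assms) auto
  moreover have "cmod (cinner (T x) x) = cmod (cinner (T e) e) * (norm x)\<^sup>2"
    by (subst x, subst (2) x)
      (simp add: bounded_clinear_props[OF assms] cinner_scaleC_left cinner_scaleC_right norm_mult
        power2_eq_square)
  ultimately show ?thesis by (simp add: mult_right_mono)
qed (simp add: bounded_clinear_props[OF assms])

text \<open>Polarization and the parallelogram law: the sum inside the modulus is half the difference of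
  the quadratic form of \<open>T\<close> at \<open>x + y\<close> and at \<open>x - y\<close>.\<close>

lemma cmod_cinner_symmetrized_le:
  assumes "bounded_clinear T"
  shows "cmod (cinner (T x) y + cinner (T y) x) \<le> numerical_radius T * ((norm x)\<^sup>2 + (norm y)\<^sup>2)"
proof -
  let ?w = "numerical_radius T"
  note T = bounded_clinear_props[OF assms]
  have Tm: "T (x - y) = T x - T y" by (rule linear_diff[OF bounded_linear.linear[OF T(1)]])
  have "2 * (cinner (T x) y + cinner (T y) x) =
      cinner (T (x + y)) (x + y) - cinner (T (x - y)) (x - y)"
    by (simp add: T(2) Tm cinner_add_left cinner_add_right cinner_bilinear.diff_left
        cinner_bilinear.diff_right)
  then have "cmod (2 * (cinner (T x) y + cinner (T y) x)) \<le>
      cmod (cinner (T (x + y)) (x + y)) + cmod (cinner (T (x - y)) (x - y))"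
    by (simp add: norm_triangle_ineq4)
  also have "\<dots> \<le> ?w * (norm (x + y))\<^sup>2 + ?w * (norm (x - y))\<^sup>2"
    by (intro add_mono cmod_cinner_le_numerical_radius assms)
  also have "\<dots> = ?w * ((norm (x + y))\<^sup>2 + (norm (x - y))\<^sup>2)" by (simp add: distrib_left)
  also have "(norm (x + y))\<^sup>2 + (norm (x - y))\<^sup>2 = 2 * ((norm x)\<^sup>2 + (norm y)\<^sup>2)"
    by (simp add: norm_power2_cinner cinner_add_left cinner_add_right cinner_bilinear.diff_left
        cinner_bilinear.diff_right)
  finally show ?thesis unfolding norm_mult by (simp add: distrib_left)
qed

text \<open>For unimodular \<open>c\<close> the operator \<open>T + c T\<^sup>*\<close> is a unimodular multiple of a self-adjoint one, and
  for such an operator \<open>S\<close> the quadratic form already determines the norm: polarization turns the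
  bound on the quadratic form into one on \<open>Re \<langle>Sx, y\<rangle>\<close>, which is \<open>\<parallel>Sx\<parallel> \<parallel>x\<parallel>\<close> for a suitable \<open>y\<close>.
  The cases \<open>c = 1\<close> and \<open>c = -1\<close> give twice the real part of \<open>T\<close> and \<open>2\<i>\<close> times its imaginary
  part.\<close>

lemma onorm_add_scaleC_cadjoint_le:
  assumes T: "bounded_clinear T" and c: "cmod c = 1"
  shows "onorm (\<lambda>x. T x + c *\<^sub>C cadjoint T x) \<le> 2 * numerical_radius T"
proof (rule onorm_bound)
  let ?w = "numerical_radius T"
  let ?S = "\<lambda>x. T x + c *\<^sub>C cadjoint T x"
  show "0 \<le> 2 * ?w" by (simp add: numerical_radius_nonneg T)
  \<comment> \<open>Rotating \<open>y\<close> by a square root \<open>d\<close> of \<open>cnj c\<close> creates the relative phase \<open>d\<^sup>2\<close> between the two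
    terms of the symmetrized form.\<close>
  define d where "d = csqrt (cnj c)"
  have d2: "d * d = cnj c" unfolding d_def by (metis power2_csqrt power2_eq_square)
  have "cmod d * cmod d = 1" using c by (metis d2 norm_mult complex_mod_cnj)
  then have d: "cmod d = 1"
    by (metis norm_ge_zero power2_eq_square power2_eq_1_iff neg_0_le_iff_le not_one_le_zero)
  have dd: "d * cnj d = 1" using d by (simp add: complex_norm_square[symmetric])
  have form: "Re (cinner (?S x) y) \<le> ?w * ((norm x)\<^sup>2 + (norm y)\<^sup>2)" for x y
  proof -
    have "cinner (cadjoint T x) y = cnj (cinner (T y) x)"
      by (metis cadjoint[OF T] cinner_commute)
    then have "Re (cinner (?S x) y) = Re (cinner (T x) y + cnj c * cinner (T y) x)"
      by (simp add: cinner_add_left cinner_scaleC_left)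
    also have "\<dots> \<le> cmod (cinner (T x) y + cnj c * cinner (T y) x)" by (rule complex_Re_le_cmod)
    also have "cinner (T x) y + cnj c * cinner (T y) x =
        d * (cinner (T x) (d *\<^sub>C y) + cinner (T (d *\<^sub>C y)) x)"
      by (simp add: bounded_clinear_props[OF T] cinner_scaleC_left cinner_scaleC_right distrib_left
          d2 dd flip: mult.assoc)
    also have "cmod \<dots> \<le> ?w * ((norm x)\<^sup>2 + (norm (d *\<^sub>C y))\<^sup>2)"
      using cmod_cinner_symmetrized_le[OF T, of x "d *\<^sub>C y"] by (simp add: norm_mult d)
    finally show ?thesis by (simp add: norm_scaleC d)
  qed
  show "norm (?S x) \<le> 2 * ?w * norm x" for x
  proof (cases "?S x = 0")
    case True
    then show ?thesis by (simp add: numerical_radius_nonneg T)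
  next
    case False
    define s where "s = norm (?S x)"
    have s: "s > 0" using False by (simp add: s_def)
    have x: "norm x > 0"
    proof -
      have "x \<noteq> 0"
        using False by (auto simp: bounded_clinear_props(4)[OF T]
            bounded_clinear_props(4)[OF bounded_clinear_cadjoint[OF T]])
      then show ?thesis by simp
    qed
    \<comment> \<open>Test with the multiple of \<open>?S x\<close> of the same length as \<open>x\<close>, which balances the two squares.\<close>
    define y where "y = complex_of_real (norm x / s) *\<^sub>C ?S x"
    have "norm y = norm x" using s by (simp add: y_def norm_scaleC s_def[symmetric] norm_divide)
    moreover have "Re (cinner (?S x) y) = norm x * s"
    proof -
      have "cinner (?S x) y = complex_of_real (norm x / s) * complex_of_real (s\<^sup>2)"
        by (simp only: y_def cinner_scaleC_right cinner_self s_def complex_cnj_complex_of_real)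
      then have "Re (cinner (?S x) y) = norm x / s * s\<^sup>2"
        by (simp only: of_real_mult[symmetric] Re_complex_of_real)
      then show ?thesis using s by (simp add: power2_eq_square)
    qed
    ultimately have "norm x * s \<le> norm x * (2 * ?w * norm x)"
      using form[of x y] by (simp add: power2_eq_square algebra_simps)
    then show ?thesis using x by (simp add: s_def)
  qed
qed

lemma bounded_clinear_cinner_left:
  assumes "bounded_clinear T"
  shows "bounded_clinear (\<lambda>u. cinner (T u) v)"
  unfolding bounded_clinear_def
  using bounded_linear_compose[OF cinner_bilinear.bounded_linear_left
      bounded_clinear_props(1)[OF assms]]
  by (simp add: bounded_clinear_props[OF assms] cinner_scaleC_left scaleC_complex_def)

text \<open>The defining relation of the adjoint is immediate between two elementary tensors. Since
  \<open>htensor_ext\<close> also applies to scalar-valued maps, it extends the relation to an arbitrary left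
  argument, which determines the adjoint on elementary tensors.\<close>

lemma cadjoint_tensor_op:
  assumes A: "bounded_clinear A" and B: "bounded_clinear B"
  shows "cadjoint (A \<otimes>\<^sub>o B) = cadjoint A \<otimes>\<^sub>o cadjoint B"
proof (rule htensor_ext)
  note T = bounded_clinear_tensor_op[OF A B]
  note A' = bounded_clinear_cadjoint[OF A] and B' = bounded_clinear_cadjoint[OF B]
  show "bounded_clinear (cadjoint (A \<otimes>\<^sub>o B))" by (rule bounded_clinear_cadjoint[OF T])
  show "bounded_clinear (cadjoint A \<otimes>\<^sub>o cadjoint B)" by (rule bounded_clinear_tensor_op[OF A' B'])
  fix x y
  have "(\<lambda>u. cinner ((A \<otimes>\<^sub>o B) u) (x \<otimes> y)) = (\<lambda>u. cinner u (cadjoint A x \<otimes> cadjoint B y))"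
    by (rule htensor_ext)
      (simp_all add: bounded_clinear_cinner_left T bounded_clinear_id tensor_op_tensor A B
        cinner_tensor cadjoint)
  then have "cinner u (cadjoint (A \<otimes>\<^sub>o B) (x \<otimes> y)) = cinner u (cadjoint A x \<otimes> cadjoint B y)" for u
    by (simp add: cadjoint[OF T, symmetric] fun_eq_iff)
  then show "cadjoint (A \<otimes>\<^sub>o B) (x \<otimes> y) = (cadjoint A \<otimes>\<^sub>o cadjoint B) (x \<otimes> y)"
    by (simp add: tensor_op_tensor A' B' cinner_ext)
qed

text \<open>A pointwise bound on a product passes to the operator norm in one factor at a time.\<close>

lemma onorm_mult_le:
  fixes C k :: real
  assumes "0 \<le> k" "0 \<le> C" "\<And>x. norm (f x) * k \<le> C * norm x"
  shows "onorm f * k \<le> C"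
proof (cases "k = 0")
  case False
  then have "onorm f \<le> C / k"
    using assms by (intro onorm_bound) (simp_all add: field_simps)
  then show ?thesis using False assms(1) by (simp add: field_simps)
qed (use assms in simp)

lemma onorm_mult_le_onorm_tensor_op:
  assumes A: "bounded_clinear A" and B: "bounded_clinear B"
  shows "onorm A * onorm B \<le> onorm (A \<otimes>\<^sub>o B)"
proof -
  let ?T = "A \<otimes>\<^sub>o B"
  note T = bounded_clinear_props(1)[OF bounded_clinear_tensor_op[OF A B]]
  have elem: "norm (A x) * norm (B y) \<le> onorm ?T * norm y * norm x" for x y
    using onorm[OF T, of "x \<otimes> y"] by (simp add: tensor_op_tensor A B norm_tensor ac_simps)
  have "onorm A * norm (B y) \<le> onorm ?T * norm y" for y
    by (rule onorm_mult_le) (simp_all add: elem onorm_pos_le[OF T])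
  then have "onorm B * onorm A \<le> onorm ?T"
    by (intro onorm_mult_le)
      (simp_all add: mult.commute onorm_pos_le[OF T] onorm_pos_le[OF bounded_clinear_props(1)[OF A]])
  then show ?thesis by (simp add: mult.commute)
qed

theorem theorem2p8:
  fixes A :: "'a::chilbert_space \<Rightarrow> 'a" and B :: "'b::chilbert_space \<Rightarrow> 'b"
  assumes "bounded_clinear A" and "bounded_clinear B"
  shows "numerical_radius (A \<otimes>\<^sub>o B) \<ge> 1/2 * onorm A * onorm B +
    1/4 * \<bar>onorm (\<lambda>v. (A \<otimes>\<^sub>o B) v + (cadjoint A \<otimes>\<^sub>o cadjoint B) v)
           - onorm (\<lambda>v. (A \<otimes>\<^sub>o B) v - (cadjoint A \<otimes>\<^sub>o cadjoint B) v)\<bar>"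
proof -
  define T where "T = A \<otimes>\<^sub>o B"
  have T: "bounded_clinear T" unfolding T_def by (rule bounded_clinear_tensor_op[OF assms])
  note bT = bounded_clinear_props(1)[OF T]
    and bT' = bounded_clinear_props(1)[OF bounded_clinear_cadjoint[OF T]]
  define p where "p = onorm (\<lambda>v. T v + cadjoint T v)"
  define m where "m = onorm A * onorm B"
  define q where "q = onorm (\<lambda>v. T v - cadjoint T v)"
  have p: "p \<le> 2 * numerical_radius T"
    using onorm_add_scaleC_cadjoint_le[OF T, of 1] by (simp add: p_def scaleC_one)
  have q: "q \<le> 2 * numerical_radius T"
    using onorm_add_scaleC_cadjoint_le[OF T, of "-1"] by (simp add: q_def)
  have "2 * onorm T = onorm (\<lambda>v. (T v + cadjoint T v) + (T v - cadjoint T v))"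
    using onorm_scaleR[OF bT, of 2] by (simp add: scaleR_2)
  also have "\<dots> \<le> p + q"
    unfolding p_def q_def
    by (intro onorm_triangle bounded_linear_add bounded_linear_sub bT bT')
  finally have "2 * m \<le> p + q"
    using onorm_mult_le_onorm_tensor_op[OF assms] by (simp add: T_def m_def)
  moreover have "\<bar>p - q\<bar> \<le> 4 * numerical_radius T - (p + q)"
    by (rule abs_leI) (use p q in linarith)+
  ultimately have "1/2 * m + 1/4 * \<bar>p - q\<bar> \<le> numerical_radius T"
    by (simp add: field_simps)
  then show ?thesis
    by (simp only: m_def p_def q_def T_def cadjoint_tensor_op[OF assms] mult.assoc)
qed

end
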